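(* For each integer $r\ge 0$ there exists a polynomial $Q_r(n)$ in $n$ of degree less than or equal to $2r$ such that $$\mathrm{op}_{n+r,n}(321)=\frac{(2n)!}{n!\,(n+r+1)!}\,Q_r(n)\qquad(n\ge 0).$$ Moreover, the polynomials $Q_r(n)$ satisfy, for $r\ge 1$, the recurrence $$\begin{aligned} 6r\,Q_r(n)=&-2(2n+1)_3\,Q_{r-1}(n+2)+2\bigl(3n^2+(3r+8)n-4r+4\bigr)(2n+1)\,Q_{r-1}(n+1)\\ &+\bigl(4n^2+4n(r+1)+14r-8\bigr)(n+r+1)\,Q_{r-1}(n)+8(n+r+2)(2n+1)_3\,Q_{r-2}(n+2)\\ &-2(8n-10r+16)(n+r+1)(2n+1)\,Q_{r-2}(n+1)-4(n+2)(n+r-1)_3\,Q_{r-2}(n)\\ &-8(n+r+1)_2(2n+1)_3\,Q_{r-3}(n+2)-8(n+2)(n+r-1)_3(2n+1)\,Q_{r-3}(n+1), \end{aligned}$$ with initial conditions $Q_0(n)=1$ and $Q_j(n)=0$ for $j<0$.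
   Context: An ordered partition of $[n]=\{1,\dots,n\}$ into $k$ blocks is a sequence $\pi=B_1/B_2/\cdots/B_k$ of nonempty pairwise disjoint subsets with union $[n]$. It contains the pattern $321$ if there exist $1\le i_1<i_2<i_3\le k$ and $b_1\in B_{i_1}$, $b_2\in B_{i_2}$, $b_3\in B_{i_3}$ with $b_1>b_2>b_3$; otherwise it avoids $321$. For $n\ge k\ge1$, $\mathrm{op}_{n,k}(321)$ is the number of ordered partitions of $[n]$ into $k$ blocks that avoid $321$. By convention $\mathrm{op}_{n,0}(321)=\delta_{n,0}$ (equal to $1$ if $n=0$ and $0$ otherwise). $(x)_m=x(x+1)\cdots(x+m-1)$ is the Pochhammer symbol. *)

theory Defs
  imports Complex_Main "HOL-Computational_Algebra.Polynomial"
begin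

definition ordered_partition :: "nat \<Rightarrow> nat \<Rightarrow> nat set list \<Rightarrow> bool" where
  "ordered_partition n k B \<longleftrightarrow>
     length B = k \<and>
     (\<forall>i<k. B ! i \<noteq> {}) \<and>
     (\<forall>i<k. \<forall>j<k. i \<noteq> j \<longrightarrow> B ! i \<inter> B ! j = {}) \<and>
     (\<Union>i<k. B ! i) = {1..n}"

definition contains_321 :: "nat set list \<Rightarrow> bool" where
  "contains_321 B \<longleftrightarrow>
     (\<exists>i\<^sub>1 i\<^sub>2 i\<^sub>3. i\<^sub>1 < i\<^sub>2 \<and> i\<^sub>2 < i\<^sub>3 \<and> i\<^sub>3 < length B \<and>
        (\<exists>b\<^sub>1\<in>B ! i\<^sub>1. \<exists>b\<^sub>2\<in>B ! i\<^sub>2. \<exists>b\<^sub>3\<in>B ! i\<^sub>3. b\<^sub>1 > b\<^sub>2 \<and> b\<^sub>2 > b\<^sub>3))"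

text \<open>
  For zero blocks, the only candidate is the empty list, which is an ordered partition of the
  empty set alone; so the convention that the number for \<open>k = 0\<close> is 1 if \<open>n = 0\<close> and 0
  otherwise needs no separate clause (see \<open>op_321_zero_blocks\<close> below).
\<close>
definition op_321 :: "nat \<Rightarrow> nat \<Rightarrow> nat" where
  "op_321 n k = card {B. ordered_partition n k B \<and> \<not> contains_321 B}"

lemma op_321_zero_blocks: "op_321 n 0 = (if n = 0 then 1 else 0)"
proof -
  have "{B. ordered_partition n 0 B \<and> \<not> contains_321 B} = (if n = 0 then {[]} else {})"
    by (auto simp: ordered_partition_def contains_321_def)
  then show ?thesis
    by (simp add: op_321_def)
qed

end

theory Submission
  imports Defs "HOL-Computational_Algebra.Formal_Power_Series"
begin

text \<open>
  Reading for \<open>n, n - 1, \<dots>, 1\<close> the number of the block that contains it turns the ordered partitions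
  avoiding 321 into words avoiding 123 in which exactly the letters below some \<open>k\<close> occur
  (\<open>op_321_eq_word_count\<close>).  Such words grow by adding the block of a new largest element, which can be an
  old block or a new one.  The possible choices and their effect are determined by the number of letters and
  one further parameter, the threshold (\<open>sum_words_Suc\<close>).

  With a catalytic variable for the second parameter this is a linear functional equation, which the kernel
  method solves (\<open>kernel_method\<close>).  Let \<open>G\<close> be the generating function, where \<open>x\<close> marks the elements
  and \<open>t\<close> the blocks.  Then
  \<open>(1 - x) * (1 + t)^2 * G = t^2 * U + (1 - x) + t * (2 - x)\<close>,
  where the series \<open>U\<close> satisfies \<open>x*t*U^2 - (1 - 2*x)*U + (1 - x) = 0\<close>.

  Because \<open>U\<close> is quadratic, its partial derivatives are linear in \<open>U\<close> over the rational functions, and so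
  are \<open>G\<close> and all its derivatives.  They lie in a two-dimensional space, spanned by 1 and \<open>U\<close>, and hence
  \<open>G\<close> satisfies many inhomogeneous linear differential equations.  One of them
  (\<open>words_gf_pde\<close>) is of second order, and its coefficients are exactly the claimed recurrence, written for
  the numbers of partitions instead of the polynomials (\<open>word_count_recurrence\<close>).

  It remains to define the polynomials by the recurrence.  The degree bound needs a cancellation among the
  leading coefficients (\<open>degree_rec_step\<close>), and the formula follows by induction on \<open>r\<close>
  (\<open>shifted_count_eq\<close>), which starts with the Catalan numbers on the diagonal (\<open>word_count_diag\<close>).
\<close>

section \<open>Words avoiding 123\<close>

text \<open>
  Words are read with the newest letter first.  A letter \<open>d\<close> that has a larger letter to its right in
  the list is the lower end of an ascent; a letter \<open>c\<close> put in front creates the pattern 123 exactly when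
  it lies below such a \<open>d\<close>.  The function below is one more than the largest lower end, and 0 if there
  is no ascent, so that the word may be extended by \<open>c\<close> iff its value is at most \<open>c + 1\<close>.
\<close>
fun threshold :: "nat list \<Rightarrow> nat" where
  "threshold [] = 0"
| "threshold (c # w) = (if \<exists>x\<in>set w. c < x then max (Suc c) (threshold w) else threshold w)"

fun avoids_123 :: "nat list \<Rightarrow> bool" where
  "avoids_123 [] = True"
| "avoids_123 (c # w) \<longleftrightarrow> avoids_123 w \<and> threshold w \<le> Suc c"

lemma threshold_le_Suc_iff:
  "threshold w \<le> Suc c \<longleftrightarrow> (\<forall>j l. j < l \<and> l < length w \<and> w ! j < w ! l \<longrightarrow> w ! j \<le> c)"
proof (induction w)
  case (Cons a w)
  have "(\<forall>j l. j < l \<and> l < length (a # w) \<and> (a # w) ! j < (a # w) ! l \<longrightarrow> (a # w) ! j \<le> c) \<longleftrightarrow>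
    (\<forall>l < length w. a < w ! l \<longrightarrow> a \<le> c) \<and> (\<forall>j l. j < l \<and> l < length w \<and> w ! j < w ! l \<longrightarrow> w ! j \<le> c)"
    (is "?L \<longleftrightarrow> ?R1 \<and> ?R2")
  proof
    assume L: ?L
    have ?R1
    proof (intro allI impI)
      fix l assume "l < length w" "a < w ! l"
      then show "a \<le> c" using L[rule_format, of 0 "Suc l"] by simp
    qed
    moreover have ?R2
    proof (intro allI impI)
      fix j l assume "j < l \<and> l < length w \<and> w ! j < w ! l"
      then show "w ! j \<le> c" using L[rule_format, of "Suc j" "Suc l"] by simp
    qed
    ultimately show "?R1 \<and> ?R2" ..
  next
    assume R: "?R1 \<and> ?R2"
    show ?L
    proof (intro allI impI)
      fix j l assume *: "j < l \<and> l < length (a # w) \<and> (a # w) ! j < (a # w) ! l"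
      then obtain l' where "l = Suc l'" by (cases l) auto
      then show "(a # w) ! j \<le> c" using R * by (cases j) auto
    qed
  qed
  moreover have "(\<forall>l < length w. a < w ! l \<longrightarrow> a \<le> c) \<longleftrightarrow> ((\<exists>x\<in>set w. a < x) \<longrightarrow> a \<le> c)"
    by (metis in_set_conv_nth)
  moreover have "threshold (a # w) \<le> Suc c \<longleftrightarrow> ((\<exists>x\<in>set w. a < x) \<longrightarrow> a \<le> c) \<and> threshold w \<le> Suc c"
    by simp
  ultimately show ?case using Cons.IH by argo
qed simp

lemma avoids_123_iff:
  "avoids_123 w \<longleftrightarrow> \<not> (\<exists>i j l. i < j \<and> j < l \<and> l < length w \<and> w ! i < w ! j \<and> w ! j < w ! l)"
proof (induction w)
  case (Cons a w)
  have "(\<exists>i j l. i < j \<and> j < l \<and> l < length (a # w) \<and> (a # w) ! i < (a # w) ! j \<and> (a # w) ! j < (a # w) ! l)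
    \<longleftrightarrow> (\<exists>i j l. i < j \<and> j < l \<and> l < length w \<and> w ! i < w ! j \<and> w ! j < w ! l) \<or>
        (\<exists>j l. j < l \<and> l < length w \<and> w ! j < w ! l \<and> a < w ! j)" (is "?L \<longleftrightarrow> ?R1 \<or> ?R2")
  proof
    assume ?L
    then obtain i j l where *: "i < j" "j < l" "l < length (a # w)" "(a # w) ! i < (a # w) ! j" "(a # w) ! j < (a # w) ! l"
      by blast
    obtain j' l' where "j = Suc j'" "l = Suc l'" using * by (metis Nat.lessE)
    then show "?R1 \<or> ?R2" using * by (cases i) auto
  next
    assume "?R1 \<or> ?R2"
    then show ?L
    proof
      assume ?R1
      then obtain i j l where "i < j" "j < l" "l < length w" "w ! i < w ! j" "w ! j < w ! l" by blast
      then show ?L by (intro exI[of _ "Suc i"] exI[of _ "Suc j"] exI[of _ "Suc l"]) simp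
    next
      assume ?R2
      then obtain j l where "j < l" "l < length w" "w ! j < w ! l" "a < w ! j" by blast
      then show ?L by (intro exI[of _ 0] exI[of _ "Suc j"] exI[of _ "Suc l"]) simp
    qed
  qed
  moreover have "threshold w \<le> Suc a \<longleftrightarrow> \<not> (\<exists>j l. j < l \<and> l < length w \<and> w ! j < w ! l \<and> a < w ! j)"
    unfolding threshold_le_Suc_iff by (meson not_le)
  moreover have "avoids_123 (a # w) \<longleftrightarrow> avoids_123 w \<and> threshold w \<le> Suc a"
    by simp
  ultimately show ?case using Cons.IH by argo
qed simp

text \<open>
  Inserting a letter \<open>c\<close> that does not occur yet, as a new block, renumbers the blocks from \<open>c\<close> on.
\<close>
definition bump :: "nat \<Rightarrow> nat \<Rightarrow> nat" where
  "bump c a = (if a < c then a else Suc a)"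

lemma bump_less_iff [simp]: "bump c a < bump c b \<longleftrightarrow> a < b"
  by (auto simp: bump_def)

lemma bump_le_iff [simp]: "bump c a \<le> bump c b \<longleftrightarrow> a \<le> b"
  by (auto simp: bump_def)

lemma bump_le_self_iff [simp]: "bump c a \<le> c \<longleftrightarrow> a < c"
  by (auto simp: bump_def)

lemma bump_eq: "a < c \<Longrightarrow> bump c a = a"
  by (simp add: bump_def)

lemma bump_neq [simp]: "bump c a \<noteq> c" "c \<noteq> bump c a"
  by (auto simp: bump_def)

lemma threshold_bump_le: "threshold (map (bump c) w) \<le> Suc (bump c a) \<longleftrightarrow> threshold w \<le> Suc a"
  by (induction w) auto

lemma avoids_123_map_bump [simp]: "avoids_123 (map (bump c) w) \<longleftrightarrow> avoids_123 w"
  by (induction w) (auto simp: threshold_bump_le)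

text \<open>
  A fresh letter \<open>c\<close> is one step more restricted than an old one: a lower end equal to \<open>c\<close> is moved
  to \<open>c + 1\<close> by the renumbering and then blocks the insertion of \<open>c\<close>.
\<close>
lemma threshold_bump_le_Suc: "threshold (map (bump c) w) \<le> Suc c \<longleftrightarrow> threshold w \<le> c"
  by (induction w) (auto simp: Suc_le_eq less_Suc_eq_le)

lemma threshold_bump: "threshold w \<le> c \<Longrightarrow> threshold (map (bump c) w) = threshold w"
  by (induction w) (auto simp: bump_eq split: if_splits)

lemma bump_image: "c \<le> k \<Longrightarrow> bump c ` {..<k} = {..<Suc k} - {c}"
proof -
  assume "c \<le> k"
  have "y \<in> bump c ` {..<k}" if "y < Suc k" "y \<noteq> c" for y
  proof (cases "y < c")
    case True
    with \<open>c \<le> k\<close> show ?thesis by (intro image_eqI[of _ _ y]) (auto simp: bump_def)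
  next
    case False
    with that show ?thesis by (intro image_eqI[of _ _ "y - 1"]) (auto simp: bump_def)
  qed
  then show ?thesis using \<open>c \<le> k\<close> by (auto simp: bump_def)
qed

text \<open>
  The letters in use are required to form an initial segment of the naturals: these are the numbers of
  the blocks, none of which is empty.
\<close>
definition words :: "nat \<Rightarrow> nat list set" where
  "words n = {w. length w = n \<and> (\<exists>k. set w = {..<k}) \<and> avoids_123 w}"

lemma wordsI: "length w = n \<Longrightarrow> set w = {..<k} \<Longrightarrow> avoids_123 w \<Longrightarrow> w \<in> words n"
  by (auto simp: words_def)

lemma wordsE:
  assumes "w \<in> words n"
  obtains k where "length w = n" "set w = {..<k}" "card (set w) = k" "avoids_123 w"
  using assms by (auto simp: words_def)

lemma words_lettersE:
  assumes "w \<in> words n"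
  obtains k where "set w = {..<k}" "card (set w) = k"
  using assms by (auto simp: words_def)

lemma words_0 [simp]: "words 0 = {[]}"
  by (auto simp: words_def)

lemma card_set_le: "w \<in> words n \<Longrightarrow> card (set w) \<le> n"
  by (metis card_length wordsE)

lemma finite_words [simp]: "finite (words n)"
proof (rule finite_subset)
  show "words n \<subseteq> {w. set w \<subseteq> {..<n} \<and> length w = n}"
  proof
    fix w assume w: "w \<in> words n"
    then obtain k where "length w = n" "set w = {..<k}" "card (set w) = k" by (rule wordsE)
    then show "w \<in> {w. set w \<subseteq> {..<n} \<and> length w = n}" using card_set_le[OF w] by auto
  qed
qed (simp add: finite_lists_length_eq)

lemma threshold_le_card:
  assumes "set w \<subseteq> {..<k}"
  shows "threshold w \<le> k"
  using assms
proof (induction w)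
  case (Cons a w)
  then show ?case by (cases "\<exists>x\<in>set w. a < x") auto
qed simp

section \<open>Ordered partitions as words\<close>

text \<open>
  The letter at position \<open>p\<close> is the number of the block that contains \<open>n - p\<close>.  In this order of reading
  the pattern 321 of the blocks becomes the pattern 123 of the word.
\<close>
definition blocks :: "nat \<Rightarrow> nat \<Rightarrow> nat list \<Rightarrow> nat set list" where
  "blocks n k w = map (\<lambda>i. {x \<in> {1..n}. w ! (n - x) = i}) [0..<k]"

lemma length_blocks [simp]: "length (blocks n k w) = k"
  by (simp add: blocks_def)

lemma mem_blocks_iff: "i < k \<Longrightarrow> x \<in> blocks n k w ! i \<longleftrightarrow> 1 \<le> x \<and> x \<le> n \<and> w ! (n - x) = i"
  by (auto simp: blocks_def)

lemma ordered_partition_blocks: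
  assumes "length w = n" "set w = {..<k}"
  shows "ordered_partition n k (blocks n k w)"
  unfolding ordered_partition_def
proof (intro conjI allI impI)
  fix i assume i: "i < k"
  then have "i \<in> set w" using assms by simp
  then obtain p where "p < n" "w ! p = i" using assms(1) by (auto simp: in_set_conv_nth)
  then have "n - p \<in> blocks n k w ! i" using i by (auto simp: mem_blocks_iff)
  then show "blocks n k w ! i \<noteq> {}" by blast
next
  have "w ! (n - x) < k" if "1 \<le> x" "x \<le> n" for x
    using nth_mem[of "n - x" w] assms that by auto
  then show "(\<Union>i<k. blocks n k w ! i) = {1..n}"
    by (auto simp: mem_blocks_iff)
qed (auto simp: mem_blocks_iff)

lemma contains_321_blocks_iff:
  assumes "length w = n" "set w = {..<k}"
  shows "contains_321 (blocks n k w) \<longleftrightarrow> \<not> avoids_123 w"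
proof
  assume "contains_321 (blocks n k w)"
  then obtain i1 i2 i3 b1 b2 b3 where "i1 < i2" "i2 < i3" "i3 < k"
    "b1 \<in> blocks n k w ! i1" "b2 \<in> blocks n k w ! i2" "b3 \<in> blocks n k w ! i3" "b1 > b2" "b2 > b3"
    by (auto simp: contains_321_def)
  then have "b1 \<le> n" "1 \<le> b3" "b1 > b2" "b2 > b3" "w ! (n - b1) < w ! (n - b2)" "w ! (n - b2) < w ! (n - b3)"
    by (auto simp: mem_blocks_iff)
  moreover from this have "n - b1 < n - b2" "n - b2 < n - b3" "n - b3 < length w"
    using assms(1) by arith+
  ultimately show "\<not> avoids_123 w" unfolding avoids_123_iff by blast
next
  assume "\<not> avoids_123 w"
  then obtain i j l where ijl: "i < j" "j < l" "l < n" "w ! i < w ! j" "w ! j < w ! l"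
    unfolding avoids_123_iff using assms(1) by blast
  have "w ! l < k" using ijl(3) assms nth_mem[of l w] by auto
  with ijl have "n - i \<in> blocks n k w ! (w ! i)" "n - j \<in> blocks n k w ! (w ! j)" "n - l \<in> blocks n k w ! (w ! l)"
    by (auto simp: mem_blocks_iff)
  moreover have "n - j < n - i" "n - l < n - j" using ijl by auto
  ultimately show "contains_321 (blocks n k w)"
    unfolding contains_321_def length_blocks
    by (intro exI[of _ "w ! i"] exI[of _ "w ! j"] exI[of _ "w ! l"] conjI
        bexI[of _ "n - i"] bexI[of _ "n - j"] bexI[of _ "n - l"] ijl \<open>w ! l < k\<close>)
qed

lemma inj_on_blocks: "inj_on (blocks n k) {w. length w = n \<and> set w = {..<k}}"
proof (rule inj_onI)
  fix v w assume v: "v \<in> {w. length w = n \<and> set w = {..<k}}" and w: "w \<in> {w. length w = n \<and> set w = {..<k}}"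
    and eq: "blocks n k v = blocks n k w"
  show "v = w"
  proof (rule nth_equalityI)
    fix p assume "p < length v"
    then have p: "p < n" "v ! p < k" using v nth_mem[of p v] by auto
    then have "n - p \<in> blocks n k v ! (v ! p)" by (simp add: mem_blocks_iff)
    then show "v ! p = w ! p" using p unfolding eq by (simp add: mem_blocks_iff)
  qed (use v w in simp)
qed

lemma ex_word_of_blocks:
  assumes "ordered_partition n k B"
  shows "\<exists>w. length w = n \<and> set w = {..<k} \<and> B = blocks n k w"
proof -
  have B: "length B = k" "\<And>i. i < k \<Longrightarrow> B ! i \<noteq> {}"
    "\<And>i j. i < k \<Longrightarrow> j < k \<Longrightarrow> i \<noteq> j \<Longrightarrow> B ! i \<inter> B ! j = {}" "(\<Union>i<k. B ! i) = {1..n}"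
    using assms by (auto simp: ordered_partition_def)
  have "\<exists>i<k. n - p \<in> B ! i" if "p < n" for p
  proof -
    have "n - p \<in> (\<Union>i<k. B ! i)" unfolding B(4) using that by simp
    then show ?thesis by blast
  qed
  then obtain idx where idx: "\<And>p. p < n \<Longrightarrow> idx p < k \<and> n - p \<in> B ! idx p" by metis
  define w where "w = map idx [0..<n]"
  have w_nth: "w ! p = idx p" if "p < n" for p using that by (simp add: w_def)
  have mem: "x \<in> B ! i \<longleftrightarrow> 1 \<le> x \<and> x \<le> n \<and> w ! (n - x) = i" if i: "i < k" for x i
  proof
    assume x: "x \<in> B ! i"
    then have xn: "1 \<le> x \<and> x \<le> n" using i B(4) by (metis UN_I atLeastAtMost_iff lessThan_iff)
    then have "idx (n - x) < k" "x \<in> B ! idx (n - x)" using idx[of "n - x"] by auto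
    then have "idx (n - x) = i" using B(3)[OF i, of "idx (n - x)"] x by blast
    then show "1 \<le> x \<and> x \<le> n \<and> w ! (n - x) = i" using xn by (simp add: w_def)
  next
    assume x: "1 \<le> x \<and> x \<le> n \<and> w ! (n - x) = i"
    then have "n - x < n" "n - (n - x) = x" by simp_all
    then show "x \<in> B ! i" using x idx[of "n - x"] w_nth[of "n - x"] by metis
  qed
  have "{..<k} \<subseteq> set w"
  proof
    fix i assume "i \<in> {..<k}"
    then obtain x where "1 \<le> x" "x \<le> n" "w ! (n - x) = i" using B(2)[of i] mem by auto
    then show "i \<in> set w" using nth_mem[of "n - x" w] by (simp add: w_def)
  qed
  moreover have "set w \<subseteq> {..<k}" using idx by (auto simp: w_def)
  moreover have "B = blocks n k w"
  proof (rule nth_equalityI)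
    fix i assume "i < length B"
    then have "i < k" by (simp add: B(1))
    then show "B ! i = blocks n k w ! i" by (intro set_eqI) (simp only: mem mem_blocks_iff)
  qed (simp add: B(1))
  moreover have "length w = n" by (simp add: w_def)
  ultimately show ?thesis by blast
qed

definition word_count :: "nat \<Rightarrow> nat \<Rightarrow> nat" where
  "word_count n k = card {w \<in> words n. card (set w) = k}"

lemma op_321_eq_word_count: "op_321 n k = word_count n k"
proof -
  let ?W = "{w. length w = n \<and> set w = {..<k} \<and> avoids_123 w}"
  have W: "{w \<in> words n. card (set w) = k} = ?W"
  proof (intro Collect_cong iffI conjI)
    fix w assume "w \<in> words n \<and> card (set w) = k"
    then show "length w = n" "set w = {..<k}" "avoids_123 w" by (auto elim: wordsE)
  next
    fix w assume "length w = n \<and> set w = {..<k} \<and> avoids_123 w"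
    then show "w \<in> words n" "card (set w) = k" by (auto intro: wordsI)
  qed
  have "{B. ordered_partition n k B \<and> \<not> contains_321 B} = blocks n k ` ?W"
  proof (intro equalityI subsetI)
    fix B assume B: "B \<in> {B. ordered_partition n k B \<and> \<not> contains_321 B}"
    then obtain w where w: "length w = n" "set w = {..<k}" "B = blocks n k w"
      using ex_word_of_blocks by blast
    with B have "avoids_123 w" using contains_321_blocks_iff by blast
    with w show "B \<in> blocks n k ` ?W" by blast
  next
    fix B assume "B \<in> blocks n k ` ?W"
    then obtain w where w: "length w = n" "set w = {..<k}" "B = blocks n k w" "avoids_123 w" by blast
    then show "B \<in> {B. ordered_partition n k B \<and> \<not> contains_321 B}"
      using ordered_partition_blocks[OF w(1,2)] contains_321_blocks_iff[OF w(1,2)] by blast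
  qed
  moreover have "inj_on (blocks n k) ?W"
    by (rule inj_on_subset[OF inj_on_blocks]) blast
  ultimately show ?thesis unfolding op_321_def word_count_def W by (simp only: card_image)
qed

section \<open>The generating tree\<close>

definition old_letters :: "nat list \<Rightarrow> nat set" where
  "old_letters w = {c. c < card (set w) \<and> threshold w \<le> Suc c}"

text \<open>
  The first letter of a word of length \<open>n + 1\<close>, that is the block of the element \<open>n + 1\<close>, either occurs again in the rest of the word or forms a block of its own; in the second case the
  rest of the word becomes a legitimate word after closing the gap that the removed letter leaves.
\<close>
lemma words_Suc:
  "words (Suc n) =
    (\<lambda>(w, c). c # w) ` Sigma (words n) old_letters \<union>
    (\<lambda>(w, c). c # map (bump c) w) ` Sigma (words n) (\<lambda>w. {threshold w..card (set w)})"
  (is "_ = ?A \<union> ?B")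
proof
  show "words (Suc n) \<subseteq> ?A \<union> ?B"
  proof
    fix v assume "v \<in> words (Suc n)"
    then obtain k where v: "length v = Suc n" "set v = {..<k}" "card (set v) = k" "avoids_123 v" by (rule wordsE)
    then obtain c w where cw: "v = c # w" by (cases v) auto
    have ins: "insert c (set w) = {..<k}" using v(2) cw by simp
    then have "c < k" by blast
    with v cw have w: "length w = n" "avoids_123 w" "threshold w \<le> Suc c" "c < k" "insert c (set w) = {..<k}"
      by simp_all
    show "v \<in> ?A \<union> ?B"
    proof (cases "c \<in> set w")
      case True
      with ins have "set w = {..<k}" by (simp add: insert_absorb)
      with w have "w \<in> words n" "c \<in> old_letters w" by (auto simp: old_letters_def intro: wordsI)
      then have "(w, c) \<in> Sigma (words n) old_letters" by simp
      then show ?thesis unfolding cw by force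
    next
      case False
      obtain k' where k': "k = Suc k'" using w by (cases k) auto
      have sw: "set w = bump c ` {..<k'}"
        using w False k' bump_image[of c k'] by auto
      define u where "u = map (\<lambda>a. if a < c then a else a - 1) w"
      have wu: "w = map (bump c) u"
        unfolding u_def map_map
      proof (rule map_idI[symmetric])
        fix a assume "a \<in> set w"
        with False have "a \<noteq> c" by blast
        then show "(bump c \<circ> (\<lambda>a. if a < c then a else a - 1)) a = a"
          by (auto simp: bump_def)
      qed
      have "set u = {..<k'}"
      proof -
        have "bump c ` set u = bump c ` {..<k'}" using wu sw by (metis list.set_map)
        moreover have "inj (bump c)" by (auto simp: inj_def bump_def split: if_splits)
        ultimately show ?thesis by (metis inj_image_eq_iff)
      qed
      moreover have "avoids_123 u" "threshold u \<le> c" "length u = n" using w threshold_bump_le_Suc[of c u] unfolding wu by auto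
      ultimately have "u \<in> words n" "c \<in> {threshold u..card (set u)}" using w k' by (auto intro: wordsI)
      then show ?thesis unfolding cw by (subst wu) force
    qed
  qed
next
  show "?A \<union> ?B \<subseteq> words (Suc n)"
  proof
    fix v assume "v \<in> ?A \<union> ?B"
    then show "v \<in> words (Suc n)"
    proof
      assume "v \<in> ?A"
      then obtain w c where *: "v = c # w" "w \<in> words n" "c \<in> old_letters w" by auto
      from *(2) obtain k where "length w = n" "set w = {..<k}" "card (set w) = k" "avoids_123 w" by (rule wordsE)
      then show ?thesis using * by (intro wordsI[of _ _ k]) (auto simp: old_letters_def)
    next
      assume "v \<in> ?B"
      then obtain w c where *: "v = c # map (bump c) w" "w \<in> words n" "threshold w \<le> c" "c \<le> card (set w)" by auto
      from *(2) obtain k where k: "length w = n" "set w = {..<k}" "card (set w) = k" "avoids_123 w" by (rule wordsE)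
      have "c \<le> k" using *(4) k(3) by simp
      then have "set v = insert c ({..<Suc k} - {c})" using *(1) k(2) bump_image[of c k] by simp
      also have "\<dots> = {..<Suc k}" using \<open>c \<le> k\<close> by auto
      finally show ?thesis using * k by (intro wordsI[of _ _ "Suc k"]) (auto simp: threshold_bump_le_Suc)
    qed
  qed
qed

text \<open>
  Number of letters and threshold of a child depend only on those of its parent and on the letter chosen,
  so these two parameters suffice for the enumeration.  The largest letter is exceptional, because it
  creates no ascent and keeps the threshold.
\<close>
lemma sum_words_Suc:
  fixes f :: "nat \<Rightarrow> nat \<Rightarrow> 'a::comm_monoid_add"
  shows "(\<Sum>w\<in>words (Suc n). f (card (set w)) (threshold w)) =
    (\<Sum>w\<in>words n. (\<Sum>c\<in>old_letters w. f (card (set w)) (if Suc c < card (set w) then Suc c else threshold w)) +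
       (\<Sum>c = threshold w..card (set w). f (Suc (card (set w))) (if c < card (set w) then Suc c else threshold w)))"
proof -
  let ?F = "\<lambda>w. f (card (set w)) (threshold w)"
  let ?A = "Sigma (words n) old_letters" and ?B = "Sigma (words n) (\<lambda>w. {threshold w..card (set w)})"
  let ?a = "\<lambda>(w, c). c # w" and ?b = "\<lambda>(w, c). c # map (bump c) w"
  have fin: "finite (old_letters w)" for w by (simp add: old_letters_def)
  have injb: "inj (bump c)" for c by (auto simp: inj_def bump_def split: if_splits)
  have inj: "inj_on ?a ?A" "inj_on ?b ?B"
    by (auto intro!: inj_onI simp: inj_map_eq_map[OF injb])
  have old: "c \<in> set w" if wn: "w \<in> words n" and cw: "c \<in> old_letters w" for w c
  proof -
    obtain k where "set w = {..<k}" "card (set w) = k" using wn by (rule words_lettersE)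
    then show ?thesis using cw by (simp add: old_letters_def)
  qed
  have disj: "?a ` ?A \<inter> ?b ` ?B = {}"
  proof (intro equals0I)
    fix v assume "v \<in> ?a ` ?A \<inter> ?b ` ?B"
    then obtain w c w' c' where "w \<in> words n" "c \<in> old_letters w" "v = c # w" "v = c' # map (bump c') w'"
      by auto
    then show False using old[of w c] by auto
  qed
  have "(\<Sum>w\<in>words (Suc n). ?F w) = (\<Sum>w\<in>?a ` ?A. ?F w) + (\<Sum>w\<in>?b ` ?B. ?F w)"
    unfolding words_Suc using fin disj by (intro sum.union_disjoint) auto
  also have "(\<Sum>w\<in>?a ` ?A. ?F w) = (\<Sum>(w, c)\<in>?A. ?F (c # w))"
    by (subst sum.reindex[OF inj(1)]) (simp add: case_prod_unfold o_def)
  also have "\<dots> = (\<Sum>w\<in>words n. \<Sum>c\<in>old_letters w. ?F (c # w))"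
    using fin by (subst sum.Sigma) auto
  also have "\<dots> = (\<Sum>w\<in>words n. \<Sum>c\<in>old_letters w. f (card (set w)) (if Suc c < card (set w) then Suc c else threshold w))"
  proof (intro sum.cong refl)
    fix w c assume *: "w \<in> words n" "c \<in> old_letters w"
    then have "c \<in> set w" by (rule old)
    obtain k where k: "set w = {..<k}" "card (set w) = k" using *(1) by (rule words_lettersE)
    have "(\<exists>x\<in>set w. c < x) \<longleftrightarrow> Suc c < k"
    proof
      assume "Suc c < k"
      then have "k - 1 \<in> set w" "c < k - 1" by (simp_all add: k(1))
      then show "\<exists>x\<in>set w. c < x" ..
    qed (auto simp: k(1))
    then show "?F (c # w) = f (card (set w)) (if Suc c < card (set w) then Suc c else threshold w)"
      using *(2) by (simp add: old_letters_def k(2) insert_absorb[OF \<open>c \<in> set w\<close>])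
  qed
  also have "(\<Sum>w\<in>?b ` ?B. ?F w) = (\<Sum>(w, c)\<in>?B. ?F (c # map (bump c) w))"
    by (subst sum.reindex[OF inj(2)]) (simp add: case_prod_unfold o_def)
  also have "\<dots> = (\<Sum>w\<in>words n. \<Sum>c = threshold w..card (set w). ?F (c # map (bump c) w))"
    by (subst sum.Sigma) auto
  also have "\<dots> = (\<Sum>w\<in>words n. \<Sum>c = threshold w..card (set w). f (Suc (card (set w))) (if c < card (set w) then Suc c else threshold w))"
  proof (intro sum.cong refl)
    fix w c assume *: "w \<in> words n" "c \<in> {threshold w..card (set w)}"
    obtain k where k: "set w = {..<k}" "card (set w) = k" using *(1) by (rule words_lettersE)
    have s: "bump c ` set w = {..<Suc k} - {c}" using bump_image[of c k] * k by simp
    then have "insert c (bump c ` set w) = {..<Suc k}" using * k by auto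
    then have "card (set (c # map (bump c) w)) = Suc k" by simp
    moreover have "(\<exists>x\<in>set (map (bump c) w). c < x) \<longleftrightarrow> c < k"
      unfolding set_map s by auto
    moreover have "threshold (map (bump c) w) = threshold w" using * by (intro threshold_bump) simp
    ultimately show "?F (c # map (bump c) w) = f (Suc (card (set w))) (if c < card (set w) then Suc c else threshold w)"
      using *(2) unfolding k(2) by (simp add: max_def)
  qed
  finally show ?thesis by (simp only: sum.distrib)
qed

section \<open>The kernel method\<close>

lemma geometric_sum_reversed:
  fixes u :: "'a::comm_ring_1"
  assumes "h \<le> k"
  shows "(u - 1) * (\<Sum>c = h..<k. u ^ (k - c)) = u * (u ^ (k - h) - 1)"
  using assms
proof (induction h rule: inc_induct)
  case (step h)
  have "{h..<k} = insert h {Suc h..<k}" using step by auto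
  moreover have "k - h = Suc (k - Suc h)" using step by simp
  ultimately show ?case using step by (simp add: algebra_simps)
qed simp

text \<open>
  For threshold \<open>h\<close> among \<open>k\<close> letters the weight is \<open>u ^ (k - h)\<close>.  The correction at \<open>h = 0\<close> occurs
  because the letter with \<open>c + 1 = 0\<close>, which the bound \<open>h \<le> c + 1\<close> would allow, does not exist.
\<close>
lemma sum_old_letters_power:
  fixes u :: "'a::comm_ring_1"
  assumes "h \<le> k"
  shows "(u - 1) * (\<Sum>c | c < k \<and> h \<le> Suc c. u ^ (k - (if Suc c < k then Suc c else h))) =
    u * (u ^ (k - h) - 1) + (u - 1) * u ^ (k - h) - (if h = 0 then (u - 1) * u ^ k else 0)"
proof (cases k)
  case (Suc k')
  have "{c. c < k \<and> h \<le> Suc c} = insert k' {h - 1..<k'}" using assms Suc by auto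
  then have "(\<Sum>c | c < k \<and> h \<le> Suc c. u ^ (k - (if Suc c < k then Suc c else h))) =
      u ^ (k - h) + (\<Sum>c = h - 1..<k'. u ^ (k' - c))"
    using Suc by simp
  moreover have "(u - 1) * (\<Sum>c = h - 1..<k'. u ^ (k' - c)) = u * (u ^ (k' - (h - 1)) - 1)"
    using assms Suc by (intro geometric_sum_reversed) simp
  ultimately show ?thesis
    using Suc by (cases h) (simp_all add: algebra_simps)
qed (use assms in simp)

lemma sum_new_letters_power:
  fixes u :: "'a::comm_ring_1"
  assumes "h \<le> k"
  shows "(u - 1) * (\<Sum>c = h..k. u ^ (Suc k - (if c < k then Suc c else h))) =
    u * (u ^ (k - h) - 1) + (u - 1) * (u * u ^ (k - h))"
proof -
  have "{h..k} = insert k {h..<k}" using assms by auto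
  then have "(\<Sum>c = h..k. u ^ (Suc k - (if c < k then Suc c else h))) =
      u * u ^ (k - h) + (\<Sum>c = h..<k. u ^ (k - c))"
    using Suc_diff_le[OF assms] by simp
  then show ?thesis using geometric_sum_reversed[OF assms, of u] by (simp add: algebra_simps)
qed

definition weighted :: "'a::comm_ring_1 \<Rightarrow> 'a \<Rightarrow> nat \<Rightarrow> 'a" where
  "weighted t u n = (\<Sum>w\<in>words n. t ^ card (set w) * u ^ (card (set w) - threshold w))"

text \<open>
  The same weights, with \<open>v = t * u\<close>, over the words without any ascent; they enter the recursion through
  the correction at threshold 0.
\<close>
definition weighted_free :: "'a::comm_ring_1 \<Rightarrow> nat \<Rightarrow> 'a" where
  "weighted_free v n = (\<Sum>w\<in>words n. if threshold w = 0 then v ^ card (set w) else 0)"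

lemma words_length: "w \<in> words n \<Longrightarrow> length w = n"
  by (simp add: words_def)

lemma threshold_le_letters: "w \<in> words n \<Longrightarrow> threshold w \<le> card (set w)"
  by (metis order_refl threshold_le_card words_lettersE)

lemma weighted_0 [simp]: "weighted t u 0 = 1" "weighted_free v 0 = 1"
  by (simp_all add: weighted_def weighted_free_def)

lemma weighted_Suc:
  "(u - 1) * weighted t u (Suc n) =
     (1 + t) * u * (weighted t u n - weighted t 1 n) + (1 + t * u) * (u - 1) * weighted t u n
     - (u - 1) * weighted_free (t * u) n"
proof -
  have "(u - 1) * weighted t u (Suc n) = (\<Sum>w\<in>words n.
      t ^ card (set w) * ((u - 1) * (\<Sum>c\<in>old_letters w. u ^ (card (set w) - (if Suc c < card (set w) then Suc c else threshold w)))) +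
      t ^ Suc (card (set w)) * ((u - 1) * (\<Sum>c = threshold w..card (set w). u ^ (Suc (card (set w)) - (if c < card (set w) then Suc c else threshold w)))))"
    unfolding weighted_def sum_words_Suc[of "\<lambda>k h. t ^ k * u ^ (k - h)"]
    by (simp only: sum_distrib_left distrib_left mult.left_commute)
  also have "\<dots> = (\<Sum>w\<in>words n.
      (1 + t) * u * (t ^ card (set w) * u ^ (card (set w) - threshold w) - t ^ card (set w))
      + (1 + t * u) * (u - 1) * (t ^ card (set w) * u ^ (card (set w) - threshold w))
      - (u - 1) * (if threshold w = 0 then (t * u) ^ card (set w) else 0))"
  proof (intro sum.cong refl)
    fix w assume w: "w \<in> words n"
    show "t ^ card (set w) * ((u - 1) * (\<Sum>c\<in>old_letters w. u ^ (card (set w) - (if Suc c < card (set w) then Suc c else threshold w)))) +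
      t ^ Suc (card (set w)) * ((u - 1) * (\<Sum>c = threshold w..card (set w). u ^ (Suc (card (set w)) - (if c < card (set w) then Suc c else threshold w)))) =
      (1 + t) * u * (t ^ card (set w) * u ^ (card (set w) - threshold w) - t ^ card (set w))
      + (1 + t * u) * (u - 1) * (t ^ card (set w) * u ^ (card (set w) - threshold w))
      - (u - 1) * (if threshold w = 0 then (t * u) ^ card (set w) else 0)"
      unfolding old_letters_def sum_old_letters_power[OF threshold_le_letters[OF w]] sum_new_letters_power[OF threshold_le_letters[OF w]]
      by (simp add: algebra_simps power_mult_distrib)
  qed
  also have "\<dots> = (1 + t) * u * (weighted t u n - weighted t 1 n) + (1 + t * u) * (u - 1) * weighted t u n
     - (u - 1) * weighted_free (t * u) n"
    by (simp only: weighted_def weighted_free_def sum.distrib sum_subtractf power_one mult_1_right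
        flip: sum_distrib_left)
  finally show ?thesis .
qed

lemma weighted_free_Suc:
  "weighted_free v (Suc n) = (1 + v) * weighted_free v n - (if n = 0 then 1 else 0)"
proof -
  have "weighted_free v (Suc n) = (\<Sum>w\<in>words n. (1 + v) * (if threshold w = 0 then v ^ card (set w) else 0) - (if w = [] then 1 else 0))"
    unfolding weighted_free_def sum_words_Suc[of "\<lambda>k h. if h = 0 then v ^ k else 0"]
  proof (intro sum.cong refl)
    fix w assume w: "w \<in> words n"
    define k where "k = card (set w)"
    have h: "threshold w \<le> k" unfolding k_def by (rule threshold_le_letters[OF w])
    have "(\<Sum>c\<in>old_letters w. if (if Suc c < k then Suc c else threshold w) = 0 then v ^ k else 0) =
      (\<Sum>c\<in>old_letters w. if c = k - 1 then if threshold w = 0 then v ^ k else 0 else 0)"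
      by (intro sum.cong refl) (auto simp: old_letters_def k_def)
    also have "\<dots> = (if k = 0 then 0 else if threshold w = 0 then v ^ k else 0)"
      using h by (subst sum.delta) (auto simp: old_letters_def k_def[symmetric])
    finally have 1: "(\<Sum>c\<in>old_letters w. if (if Suc c < k then Suc c else threshold w) = 0 then v ^ k else 0) =
      (if k = 0 then 0 else if threshold w = 0 then v ^ k else 0)" .
    have "(\<Sum>c = threshold w..k. if (if c < k then Suc c else threshold w) = 0 then v ^ Suc k else 0) =
      (\<Sum>c = threshold w..k. if c = k then if threshold w = 0 then v ^ Suc k else 0 else 0)"
      by (intro sum.cong refl) auto
    also have "\<dots> = (if threshold w = 0 then v ^ Suc k else 0)"
      using h by (subst sum.delta) auto
    finally have 2: "(\<Sum>c = threshold w..k. if (if c < k then Suc c else threshold w) = 0 then v ^ Suc k else 0) =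
      (if threshold w = 0 then v ^ Suc k else 0)" .
    have 3: "k = 0 \<longleftrightarrow> w = []" by (simp add: k_def)
    show "(\<Sum>c\<in>old_letters w. if (if Suc c < card (set w) then Suc c else threshold w) = 0 then v ^ card (set w) else 0) +
       (\<Sum>c = threshold w..card (set w). if (if c < card (set w) then Suc c else threshold w) = 0 then v ^ Suc (card (set w)) else 0)
      = (1 + v) * (if threshold w = 0 then v ^ card (set w) else 0) - (if w = [] then 1 else 0)"
      unfolding k_def[symmetric] 1 2 using 3 h by (auto simp: algebra_simps)
  qed
  also have "\<dots> = (1 + v) * weighted_free v n - (\<Sum>w\<in>words n. if w = [] then 1 else 0)"
    by (simp only: sum_subtractf sum_distrib_left weighted_free_def)
  also have "(\<Sum>w\<in>words n. if w = [] then 1 else 0) = (if n = 0 then 1 else (0::'a))"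
    unfolding sum.delta[OF finite_words] by (cases n) (auto dest: words_length)
  finally show ?thesis .
qed

unbundle fps_syntax

text \<open>
  This is the sum of \<open>fps_X ^ n * F n\<close> over all \<open>n\<close>, which converges formally.  It permits to evaluate
  the catalytic variable \<open>u\<close> at a power series.
\<close>
definition fps_series :: "(nat \<Rightarrow> 'a::comm_ring_1 fps) \<Rightarrow> 'a fps" where
  "fps_series F = Abs_fps (\<lambda>m. \<Sum>n\<le>m. F n $ (m - n))"

lemma fps_series_Suc: "fps_series F = F 0 + fps_X * fps_series (\<lambda>n. F (Suc n))"
proof (rule fps_ext)
  fix m show "fps_series F $ m = (F 0 + fps_X * fps_series (\<lambda>n. F (Suc n))) $ m"
    by (cases m) (simp_all add: fps_series_def sum.atMost_Suc_shift del: sum.atMost_Suc)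
qed

lemma fps_series_mult_left: "fps_series (\<lambda>n. a * F n) = a * fps_series F"
proof (rule fps_ext)
  fix m show "fps_series (\<lambda>n. a * F n) $ m = (a * fps_series F) $ m"
  proof (induction m arbitrary: F)
    case 0
    then show ?case by (simp add: fps_series_def)
  next
    case (Suc m)
    have "a * fps_series F = a * F 0 + fps_X * (a * fps_series (\<lambda>n. F (Suc n)))"
      by (subst fps_series_Suc) (simp add: algebra_simps)
    then show ?case
      using Suc[of "\<lambda>n. F (Suc n)"] by (subst fps_series_Suc) simp
  qed
qed

lemma fps_series_add: "fps_series (\<lambda>n. F n + H n) = fps_series F + fps_series H"
  by (rule fps_ext) (simp add: fps_series_def sum.distrib)

lemma fps_series_diff: "fps_series (\<lambda>n. F n - H n) = fps_series F - fps_series H"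
  by (rule fps_ext) (simp add: fps_series_def sum_subtractf)

lemma fps_series_const: "fps_series (\<lambda>n. fps_const (a n)) = Abs_fps a"
proof (rule fps_ext)
  fix m
  have "(\<Sum>n\<le>m. fps_const (a n) $ (m - n)) = (\<Sum>n\<le>m. if n = m then a n else 0)"
    by (intro sum.cong) auto
  then show "fps_series (\<lambda>n. fps_const (a n)) $ m = Abs_fps a $ m"
    by (simp add: fps_series_def)
qed

lemma fps_series_delta: "fps_series (\<lambda>n. if n = 0 then 1 else 0) = 1"
  by (subst fps_series_Suc) (simp add: fps_series_def fps_eq_iff)

text \<open>
  Summing the recursion for \<open>weighted t u n\<close> over \<open>n\<close> gives an equation of the form
  \<open>kernel * \<Phi>(u) + X * (1 + T) * u * G = (u - 1) * (1 - X * P)\<close>, where \<open>\<Phi>(u)\<close> and \<open>G = \<Phi>(1)\<close> are both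
  unknown.  At a root \<open>U\<close> of the kernel the first unknown disappears and \<open>G\<close> is a rational expression
  in \<open>U\<close>; reduced by the quadratic equation of \<open>U\<close> it becomes linear in \<open>U\<close>.
\<close>
lemma kernel_method:
  fixes t :: "'a::idom" and U :: "'a fps"
  defines "T \<equiv> fps_const t" and "X \<equiv> fps_X"
  assumes kernel: "X * T * U^2 - (1 - 2 * X) * U + (1 - X) = 0"
  defines "G \<equiv> Abs_fps (weighted t 1)"
  shows "(1 - X) * (1 + T)^2 * G = T^2 * U + (1 - X) + T * (2 - X)"
proof -
  define \<Phi> where "\<Phi> = fps_series (weighted T U)"
  define P where "P = fps_series (weighted_free (T * U))"
  have w1: "weighted T 1 n = fps_const (weighted t 1 n)" for n
    by (auto simp: weighted_def T_def fps_eq_iff fps_sum_nth fps_const_power)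
  have G: "fps_series (weighted T 1) = G"
    unfolding G_def fps_series_const[symmetric] by (rule arg_cong[where f = fps_series]) (simp add: w1 fun_eq_iff)
  have 1: "\<Phi> = 1 + X * fps_series (\<lambda>n. weighted T U (Suc n))"
    unfolding \<Phi>_def X_def by (subst fps_series_Suc) simp
  have 2: "(U - 1) * fps_series (\<lambda>n. weighted T U (Suc n)) =
    (1 + T) * U * (\<Phi> - G) + (1 + T * U) * (U - 1) * \<Phi> - (U - 1) * P"
    unfolding fps_series_mult_left[symmetric] weighted_Suc fps_series_diff fps_series_add
    unfolding fps_series_mult_left fps_series_diff G \<Phi>_def[symmetric] P_def[symmetric] ..
  have 3: "P = 1 + X * ((1 + T * U) * P - 1)"
    unfolding P_def X_def
    by (subst fps_series_Suc) (simp only: weighted_free_Suc fps_series_diff fps_series_mult_left fps_series_delta weighted_0)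
  have "(U - 1) * \<Phi> = (U - 1) + X * ((1 + T) * U * (\<Phi> - G) + (1 + T * U) * (U - 1) * \<Phi> - (U - 1) * P)"
    using 1 2 by algebra
  \<comment> \<open>The coefficient of \<open>\<Phi>\<close> vanishes, as it is the kernel.\<close>
  then have 4: "X * (1 + T) * U * G = (U - 1) * (1 - X * P)"
    using kernel by algebra
  have "X * U * (1 - X - X * T * U) * ((1 - X) * (1 + T)^2 * G - (T^2 * U + (1 - X) + T * (2 - X))) = 0"
    using 3 4 kernel by algebra
  moreover have "X \<noteq> 0" unfolding X_def by simp
  moreover have "U \<noteq> 0"
    using kernel fps_nonzeroI[of "1 - X" 0] by (auto simp: X_def)
  moreover have "(1 - X - X * T * U) $ 0 = 1"
    by (simp add: X_def fps_mult_nth_0)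
  then have "1 - X - X * T * U \<noteq> 0" by (metis fps_zero_nth zero_neq_one)
  ultimately show ?thesis by simp
qed

section \<open>The generating function and its derivatives\<close>

text \<open>
  The kernel equation reads \<open>U = (1 - X) + 2 * X * U + X * t * U^2\<close>, which determines the coefficients of
  \<open>U\<close> one after the other.
\<close>
fun kernel_coeff :: "'a::comm_ring_1 \<Rightarrow> nat \<Rightarrow> 'a" where
  "kernel_coeff t 0 = 1"
| "kernel_coeff t (Suc n) =
     2 * kernel_coeff t n + t * (\<Sum>i\<le>n. kernel_coeff t i * kernel_coeff t (n - i)) - (if n = 0 then 1 else 0)"

definition kernel_root :: "'a::comm_ring_1 \<Rightarrow> 'a fps" where
  "kernel_root t = Abs_fps (kernel_coeff t)"

lemma kernel_root:
  fixes t :: "'a::idom"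
  shows "fps_X * fps_const t * (kernel_root t)^2 - (1 - 2 * fps_X) * kernel_root t + (1 - fps_X) = 0"
proof -
  have "kernel_root t = (1 - fps_X) + fps_X * (2 * kernel_root t + fps_const t * (kernel_root t * kernel_root t))"
  proof (rule fps_ext)
    fix n
    show "kernel_root t $ n = ((1 - fps_X) + fps_X * (2 * kernel_root t + fps_const t * (kernel_root t * kernel_root t))) $ n"
      by (cases n) (simp_all add: kernel_root_def fps_mult_nth[of "Abs_fps _" "Abs_fps _"] atMost_atLeast0 numeral_fps_const)
  qed
  then show ?thesis by algebra
qed

text \<open>
  In a bivariate series the outer variable marks the length of the word and the inner one the number of
  letters.  The Euler operators of the two variables multiply the coefficient at \<open>(n, k)\<close> by \<open>n\<close> and
  by \<open>k\<close>; therefore recurrences with coefficients polynomial in \<open>n\<close> and \<open>k\<close> are differential equations.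
\<close>
definition euler_x :: "'a::comm_ring_1 fps \<Rightarrow> 'a fps" where
  "euler_x F = fps_X * fps_deriv F"

definition euler_t :: "'a::comm_ring_1 fps fps \<Rightarrow> 'a fps fps" where
  "euler_t F = Abs_fps (\<lambda>n. euler_x (F $ n))"

lemma euler_x_nth [simp]: "euler_x F $ n = of_nat n * F $ n"
  by (cases n) (simp_all add: euler_x_def)

lemma euler_t_nth [simp]: "euler_t F $ n = euler_x (F $ n)"
  by (simp add: euler_t_def)

lemma euler_x_simps [simp]:
  "euler_x (F + H) = euler_x F + euler_x H"
  "euler_x (F - H) = euler_x F - euler_x H"
  "euler_x (F * H) = euler_x F * H + F * euler_x H"
  "euler_x fps_X = fps_X"
  "euler_x (fps_const c) = 0"
  "euler_x 1 = 0" "euler_x 0 = 0" "euler_x (numeral k) = 0"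
  by (simp_all add: euler_x_def algebra_simps numeral_fps_const)

lemma euler_x_sum: "euler_x (\<Sum>i\<in>A. F i) = (\<Sum>i\<in>A. euler_x (F i))"
  by (simp add: euler_x_def fps_deriv_sum sum_distrib_left)

lemma euler_t_simps [simp]:
  "euler_t (F + H) = euler_t F + euler_t H"
  "euler_t (F - H) = euler_t F - euler_t H"
  "euler_t (F * H) = euler_t F * H + F * euler_t H"
  "euler_t fps_X = 0"
  "euler_t (fps_const c) = fps_const (euler_x c)"
  "euler_t 1 = 0" "euler_t 0 = 0" "euler_t (numeral k) = 0"
  by (rule fps_ext; simp add: fps_mult_nth euler_x_sum sum.distrib numeral_fps_const)+

definition words_gf :: "rat fps fps" where
  "words_gf = Abs_fps (weighted fps_X 1)"

lemma words_gf_nth: "words_gf $ n $ k = of_nat (word_count n k)"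
proof -
  have "words_gf $ n $ k = (\<Sum>w\<in>words n. if card (set w) = k then 1 else 0)"
    by (auto simp: words_gf_def weighted_def fps_sum_nth intro!: sum.cong)
  also have "\<dots> = of_nat (word_count n k)"
    by (simp add: word_count_def sum.If_cases Int_def)
  finally show ?thesis .
qed

lemma word_count_eq_0: "n < k \<Longrightarrow> word_count n k = 0"
  using card_set_le by (fastforce simp: word_count_def)

text \<open>
  Differentiating the kernel equation gives \<open>S * euler_x U = U - 1\<close> with \<open>S = (1 - 2*X) - 2*X*T*U\<close>.
  The square of \<open>S\<close> is the discriminant of the kernel and free of \<open>U\<close>; a second multiplication by \<open>S\<close>
  thus gives a differential equation linear in \<open>U\<close>.  The same works for the other variable.
\<close>
lemma kernel_root_euler:
  fixes U :: "'a::idom fps fps"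
  defines "U \<equiv> kernel_root fps_X" and "X \<equiv> fps_X" and "T \<equiv> fps_const fps_X"
  shows "((1-2*X)^2 - 4*X*T*(1-X)) * euler_x U = (2*X*T-1+2*X)*U+1" (is ?x)
    and "((1-2*X)^2 - 4*X*T*(1-X)) * euler_t U = (2*X*T*(1-X)-(1-2*X)^2)*U+(1-X)*(1-2*X)" (is ?t)
proof -
  have k: "X * T * (U * U) - (1 - 2 * X) * U + (1 - X) = 0"
    using kernel_root[of "fps_X :: 'a fps"] by (simp add: U_def X_def T_def power2_eq_square)
  have dX: "euler_x X = X" "euler_x T = 0" "euler_t X = 0" "euler_t T = T"
    by (simp_all add: X_def T_def)
  have "euler_x (X * T * (U * U) - (1 - 2 * X) * U + (1 - X)) = 0"
    "euler_t (X * T * (U * U) - (1 - 2 * X) * U + (1 - X)) = 0"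
    unfolding k by simp_all
  then have x: "X * T * (U * U) + X * T * (2 * U * euler_x U) + 2 * X * U - (1 - 2 * X) * euler_x U - X = 0"
    and t: "X * T * (U * U) + X * T * (2 * U * euler_t U) - (1 - 2 * X) * euler_t U = 0"
    by (simp_all add: dX algebra_simps)
  show ?x using k x by algebra
  show ?t using k t by algebra
qed

lemma fps_fps_nonzeroI:
  fixes F :: "rat fps fps"
  assumes "F $ 0 $ 0 \<noteq> 0"
  shows "F \<noteq> 0"
  using assms by auto

lemma words_gf_closed_form:
  defines "X \<equiv> fps_X" and "T \<equiv> fps_const fps_X"
  shows "(1 - X) * (1 + T)^2 * words_gf = T^2 * kernel_root fps_X + (1 - X) + T * (2 - X)"
  using kernel_method[OF kernel_root[of "fps_X :: rat fps"]]
  by (simp add: X_def T_def words_gf_def)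

section \<open>The differential equation\<close>

text \<open>
  The algebraic content of the differential equation.  Here \<open>aG\<close>, \<open>bG\<close>, \<open>abG\<close> stand for the images of
  \<open>G\<close> under the two Euler operators and their composition, and likewise for \<open>U\<close>; the hypotheses are the
  closed form of \<open>G\<close> and the differential equations of \<open>U\<close>, together with their derivatives.  They express
  everything as a linear polynomial in \<open>U\<close> over a common denominator \<open>M\<close>, after which the claim is a
  polynomial identity.
\<close>
lemma second_order_relation:
  fixes x t U G aG bG abG aU bU abU :: "'a::idom"
  defines "w \<equiv> 1 - x" and "v \<equiv> 1 + t" and "d \<equiv> (1-2*x)^2 - 4*x*t*(1-x)"
  assumes nz: "w \<noteq> 0" "v \<noteq> 0" "d \<noteq> 0"
  and e0: "w*v^2*G = t^2*U + w + t*(2-x)"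
  and ea: "w*v^2*aG - x*v^2*G = t^2*aU - x - t*x"
  and eb: "2*t*v*w*G + w*v^2*bG = 2*t^2*U + t^2*bU + t*(2-x)"
  and eab: "w*v^2*abG - 2*x*t*v*G - x*v^2*bG + 2*t*v*w*aG = 2*t^2*aU + t^2*abU - t*x"
  and ua: "d*aU = (2*x*t-1+2*x)*U+1"
  and ub: "d*bU = (2*x*t*(1-x)-(1-2*x)^2)*U+(1-x)*(1-2*x)"
  and uab: "d*abU - 4*x*t*(1-x)*aU = 2*x*t*U + (2*x*t-1+2*x)*bU"
  shows "6*x*t^2*(aG-bG) + (1-8*x+12*x^2-8*x*t+12*x^2*t-4*x^3*t) =
    -(abG+bG-aG-G) + x*t*(3*abG-7*aG+12*bG-8*G) + x^2*t^2*(4*abG-6*bG+14*aG+6*G)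
    + 4*x*(abG+2*bG-aG-2*G) - x^2*t*(18*bG-10*aG-12*G) - 4*x^3*t^2*(abG+bG+2*aG+2*G)
    - 4*x^2*(abG+3*bG-aG-3*G) - 4*x^3*t*(abG+bG+aG+G)" (is "?L = ?R")
proof -
  define c where "c = t^2*U + w + t*(2-x)"
  have a: "w^2*v^2*aG = w*(t^2*aU - x - t*x) + x*c"
    using e0 ea unfolding c_def by algebra
  have b: "w*v^3*bG = v*(2*t^2*U + t^2*bU + t*(2-x)) - 2*t*c"
    using e0 eb unfolding c_def by algebra
  have ab: "w^2*v^3*abG = w*v*(2*t^2*aU + t^2*abU - t*x) + x*(v*(2*t^2*U + t^2*bU + t*(2-x)) - 2*t*c) + 2*x*t*c
     - 2*t*(w*(t^2*aU - x - t*x) + x*c)"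
    using e0 a b eab unfolding c_def by algebra
  define A where "A = (2*x*t-1+2*x)*U+1"
  define B where "B = (2*x*t*(1-x)-(1-2*x)^2)*U+(1-x)*(1-2*x)"
  have ab2: "d^2*abU = d*2*x*t*U + (2*x*t-1+2*x)*B + 4*x*t*(1-x)*A"
    using ua ub uab unfolding A_def B_def by algebra
  define C where "C = d*2*x*t*U + (2*x*t-1+2*x)*B + 4*x*t*(1-x)*A"
  define M where "M = w^2*v^3*d^2"
  have m0: "M*G = w*v*d^2*c" using e0 unfolding M_def c_def by algebra
  have ma: "M*aG = v*(w*(t^2*A*d - d^2*x - d^2*t*x) + d^2*x*c)" using a ua unfolding M_def A_def by algebra
  have mb: "M*bG = w*(v*(d^2*2*t^2*U + t^2*B*d + d^2*t*(2-x)) - d^2*2*t*c)" using b ub unfolding M_def B_def by algebra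
  have mab: "M*abG = w*v*(2*t^2*A*d + t^2*C - d^2*t*x) + x*(v*(2*t^2*U*d^2 + t^2*B*d + d^2*t*(2-x)) - d^2*2*t*c) + d^2*2*x*t*c
     - 2*t*(w*(t^2*A*d - d^2*x - d^2*t*x) + d^2*x*c)"
    using ab ua ub ab2 unfolding M_def B_def[symmetric] A_def[symmetric] C_def[symmetric] by algebra
  have "M*(?L - ?R) = 6*x*t^2*(M*aG-M*bG) + M*(1-8*x+12*x^2-8*x*t+12*x^2*t-4*x^3*t) -
   ( -(M*abG+M*bG-M*aG-M*G) + x*t*(3*(M*abG)-7*(M*aG)+12*(M*bG)-8*(M*G)) + x^2*t^2*(4*(M*abG)-6*(M*bG)+14*(M*aG)+6*(M*G))
    + 4*x*(M*abG+2*(M*bG)-M*aG-2*(M*G)) - x^2*t*(18*(M*bG)-10*(M*aG)-12*(M*G)) - 4*x^3*t^2*(M*abG+M*bG+2*(M*aG)+2*(M*G))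
    - 4*x^2*(M*abG+3*(M*bG)-M*aG-3*(M*G)) - 4*x^3*t*(M*abG+M*bG+M*aG+M*G))" by algebra
  also have "\<dots> = 0"
    unfolding m0 ma mb mab unfolding M_def c_def C_def A_def B_def w_def v_def d_def by algebra
  finally show ?thesis using nz unfolding M_def by simp
qed

text \<open>
  The differential equation whose coefficients are the claimed recurrence.  The polynomial on the left has
  degree one in \<open>T\<close>; it accounts for the coefficients at \<open>T^0\<close> and \<open>T^1\<close>, where the shifted recurrence
  would refer to a negative number of blocks.
\<close>
lemma words_gf_pde:
  defines "X \<equiv> fps_X" and "T \<equiv> fps_const fps_X" and "G \<equiv> words_gf"
  defines "aG \<equiv> euler_x G" and "bG \<equiv> euler_t G" and "abG \<equiv> euler_t (euler_x G)"
  shows "6*X*T^2*(aG-bG) + (1-8*X+12*X^2-8*X*T+12*X^2*T-4*X^3*T) =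
    -(abG+bG-aG-G) + X*T*(3*abG-7*aG+12*bG-8*G) + X^2*T^2*(4*abG-6*bG+14*aG+6*G)
    + 4*X*(abG+2*bG-aG-2*G) - X^2*T*(18*bG-10*aG-12*G) - 4*X^3*T^2*(abG+bG+2*aG+2*G)
    - 4*X^2*(abG+3*bG-aG-3*G) - 4*X^3*T*(abG+bG+aG+G)"
proof -
  define U where "U = (kernel_root fps_X :: rat fps fps)"
  define d where "d = (1-2*X)^2 - 4*X*T*(1-X)"
  have dX: "euler_x X = X" "euler_x T = 0" "euler_t X = 0" "euler_t T = T"
    by (simp_all add: X_def T_def)
  have e0: "(1 - X) * ((1 + T) * (1 + T)) * G = T * T * U + (1 - X) + T * (2 - X)"
    using words_gf_closed_form by (simp add: X_def T_def U_def G_def power2_eq_square)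
  have ea: "(1 - X) * ((1 + T) * (1 + T)) * aG - X * ((1 + T) * (1 + T)) * G = T * T * euler_x U - X - T * X"
    using arg_cong[OF e0, of euler_x] by (simp add: dX aG_def algebra_simps)
  have eb: "2*T*(1+T)*(1-X)*G + (1-X)*((1+T)*(1+T))*bG = 2*(T*T)*U + T*T*euler_t U + T*(2-X)"
    using arg_cong[OF e0, of euler_t] by (simp add: dX bG_def algebra_simps)
  have eab: "(1-X)*((1+T)*(1+T))*abG - 2*X*T*(1+T)*G - X*((1+T)*(1+T))*bG + 2*T*(1+T)*(1-X)*aG
      = 2*(T*T)*euler_x U + T*T*euler_t (euler_x U) - T*X"
    using arg_cong[OF ea, of euler_t] by (simp add: dX bG_def abG_def aG_def[symmetric] algebra_simps)
  have ua: "d * euler_x U = (2*X*T-1+2*X)*U+1"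
    and ub: "d * euler_t U = (2*X*T*(1-X)-(1-2*X)^2)*U+(1-X)*(1-2*X)"
    using kernel_root_euler[where ?'a = rat] unfolding d_def U_def X_def T_def by blast+
  have "euler_t d = - 4*X*T*(1-X)"
    unfolding d_def power2_eq_square by (simp add: dX)
  moreover have "euler_t d * euler_x U + d * euler_t (euler_x U) = 2*X*T*U + (2*X*T-1+2*X) * euler_t U"
    using arg_cong[OF ua, of euler_t] by (simp add: dX)
  ultimately have uab: "d * euler_t (euler_x U) - 4*X*T*(1-X)*euler_x U = 2*X*T*U + (2*X*T-1+2*X) * euler_t U"
    by algebra
  have nz: "1 - X \<noteq> 0" "1 + T \<noteq> 0" "d \<noteq> 0"
    by (rule fps_fps_nonzeroI; simp add: X_def T_def d_def power2_eq_square)+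
  show ?thesis
    using nz e0 ea eb eab ua ub uab unfolding d_def power2_eq_square[symmetric] by (rule second_order_relation)
qed

section \<open>Coefficient extraction\<close>

text \<open>
  This is the coefficient of the differential equation at \<open>X ^ (n + m + 2) * T ^ (n + 2)\<close>.  The last two
  terms come with the factor \<open>X ^ 3\<close>, which exceeds the exponent of \<open>X\<close> if \<open>n + m = 0\<close>.
\<close>
lemma word_count_recurrence:
  fixes m n :: nat
  defines "g \<equiv> \<lambda>i k. rat_of_nat (word_count i k)" and "N \<equiv> rat_of_nat n + rat_of_nat m + 1" and "K \<equiv> rat_of_nat n"
  shows "6 * (N - K) * g (n+m+1) n =
    - (K + 1) * (N + 2) * g (n+m+2) (n+2) + (3*N*K + 12*K - 4*N + 4) * g (n+m+1) (n+1)
    + (4*N*K - 10*K + 14*N - 8) * g (n+m) n + 4 * (K + 1) * (N + 2) * g (n+m+1) (n+2)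
    - (18*K - 10*N + 16) * g (n+m) (n+1) - 4 * (K + 1) * (N + 2) * g (n+m) (n+2)
    - (if n + m = 0 then 0 else 4 * (K + 2) * (N - 1) * (g (n+m-1) n + g (n+m-1) (n+1)))"
proof -
  define X T :: "rat fps fps" where "X = fps_X" and "T = fps_const fps_X"
  define G where "G = words_gf"
  define aG bG abG where "aG = euler_x G" and "bG = euler_t G" and "abG = euler_t aG"
  \<comment> \<open>The factors are nested in order to strip off one variable at a time when coefficients are taken.\<close>
  have eq: "X*(T*(T*(6*(aG-bG)))) + (1-X*8+X*(X*12)-X*(T*8)+X*(X*(T*12))-X*(X*(X*(T*4)))) =
    -(abG+bG-aG-G) + X*(T*(3*abG-7*aG+12*bG-8*G)) + X*(X*(T*(T*(4*abG-6*bG+14*aG+6*G))))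
    + X*(4*(abG+2*bG-aG-2*G)) - X*(X*(T*(18*bG-10*aG-12*G))) - X*(X*(X*(T*(T*(4*(abG+bG+2*aG+2*G))))))
    - X*(X*(4*(abG+3*bG-aG-3*G))) - X*(X*(X*(T*(4*(abG+bG+aG+G)))))"
    using words_gf_pde unfolding X_def[symmetric] T_def[symmetric] G_def[symmetric] aG_def[symmetric] bG_def[symmetric]
    unfolding abG_def[symmetric]
    by (simp add: algebra_simps power2_eq_square power3_eq_cube)
  have X0: "(X * F) $ 0 = 0" and XS: "(X * F) $ (Suc i) = F $ i" for F i
    by (simp_all add: X_def)
  have T0: "(T * F) $ i $ 0 = 0" and TS: "(T * F) $ i $ (Suc k) = F $ i $ k" for F i k
    by (simp_all add: T_def)
  have num: "((numeral q :: rat fps fps) * F) $ i $ k = numeral q * F $ i $ k" for q F i k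
    by (simp add: numeral_fps_const)
  have num': "(numeral q :: rat fps fps) $ i $ Suc k = 0" for q i k
    by (simp add: numeral_fps_const)
  have one: "(1 :: rat fps fps) $ i $ Suc k = 0" for i k
    by simp
  have Gn: "G $ i $ k = g i k" for i k by (simp add: G_def words_gf_nth g_def)
  have an: "aG $ i $ k = rat_of_nat i * g i k" for i k
    by (simp add: aG_def Gn[symmetric] flip: fps_of_nat)
  have bn: "bG $ i $ k = rat_of_nat k * g i k" for i k
    by (simp add: bG_def Gn[symmetric])
  have abn: "abG $ i $ k = rat_of_nat k * (rat_of_nat i * g i k)" for i k
    by (simp add: abG_def an)
  note expand = fps_add_nth fps_sub_nth fps_neg_nth XS X0 TS T0 num num' one Gn an bn abn
  have co: "L = R \<Longrightarrow> L $ Suc (Suc (n + m)) $ Suc (Suc n) = R $ Suc (Suc (n + m)) $ Suc (Suc n)"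
    for L R :: "rat fps fps" by simp
  show ?thesis
  proof (cases "n + m")
    case 0
    then have nm: "n = 0" "m = 0" by simp_all
    show ?thesis
      using co[OF eq, unfolded expand 0, unfolded expand]
      by (simp add: N_def K_def nm algebra_simps numeral_2_eq_2)
  next
    case (Suc i)
    have i: "rat_of_nat i = rat_of_nat n + rat_of_nat m - 1"
      using arg_cong[OF Suc, of rat_of_nat] by simp
    have idx: "n + m + 1 = Suc (Suc i)" "n + m + 2 = Suc (Suc (Suc i))" "n + m - 1 = i"
      "n + 1 = Suc n" "n + 2 = Suc (Suc n)" using Suc by simp_all
    show ?thesis
      unfolding idx Suc using co[OF eq, unfolded expand Suc, unfolded expand]
      by (simp add: N_def K_def i algebra_simps)
  qed
qed

text \<open>
  Since a word has at most as many letters as its length, on and above the diagonal only the terms with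
  \<open>T^2\<close> contribute to the coefficients of the closed form.
\<close>
lemma kernel_root_diag: "kernel_root fps_X $ n $ k = rat_of_nat (word_count n k)" if "n \<le> k" "k > 0"
proof -
  define X T :: "rat fps fps" where "X = fps_X" and "T = fps_const fps_X"
  define G where "G = words_gf"
  define U where "U = (kernel_root fps_X :: rat fps fps)"
  have eq: "G + 2 * (T * G) + T * (T * G) - X * (G + 2 * (T * G) + T * (T * G)) = T * (T * U) + 1 - X + 2 * T - T * X"
    using words_gf_closed_form unfolding X_def[symmetric] T_def[symmetric] G_def[symmetric] U_def[symmetric]
    by (simp add: algebra_simps power2_eq_square)
  have T0: "(T * F) $ i $ 0 = 0" and TS: "(T * F) $ i $ (Suc k) = F $ i $ k" for F i k
    by (simp_all add: T_def)
  have X0: "(X * F) $ 0 = 0" and XS: "(X * F) $ (Suc i) = F $ i" for F i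
    by (simp_all add: X_def)
  have num: "((2 :: rat fps fps) * F) $ i $ k = 2 * F $ i $ k" for F i k
    by (simp add: numeral_fps_const)
  have Gn: "G $ i $ k = rat_of_nat (word_count i k)" for i k by (simp add: G_def words_gf_nth)
  have low: "X $ i $ Suc k = 0" "T $ i $ Suc (Suc k) = 0" "(T * X) $ i $ Suc (Suc k) = 0" "(2 * T) $ i $ Suc (Suc k) = 0" for i k
    by (simp_all add: X_def T_def TS num numeral_fps_const)
  have "(G + 2 * (T * G) + T * (T * G) - X * (G + 2 * (T * G) + T * (T * G))) $ n $ Suc (Suc k) = U $ n $ k"
    unfolding eq by (simp add: TS low)
  moreover have "(X * (G + 2 * (T * G) + T * (T * G))) $ n $ Suc (Suc k) = 0"
  proof (cases n)
    case (Suc m)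
    with that show ?thesis by (auto simp: XS num TS Gn word_count_eq_0)
  qed (simp only: X0 fps_zero_nth)
  ultimately show ?thesis using that
    by (auto simp: num TS Gn word_count_eq_0 U_def)
qed

lemma catalan_ratio:
  fixes x f F :: "'a::field"
  assumes "x + 1 \<noteq> 0" "x + 2 \<noteq> 0" "f \<noteq> 0"
  shows "(4 * x + 2) * (F / (f * ((x + 1) * f))) / (x + 2) =
    (2 * x + 2) * (2 * x + 1) * F / ((x + 1) * f * ((x + 2) * ((x + 1) * f)))"
proof -
  have "(2 * x + 2) * (2 * x + 1) * F / ((x + 1) * f * ((x + 2) * ((x + 1) * f))) =
    ((x + 1) * ((4 * x + 2) * F)) / ((x + 1) * (f * ((x + 1) * f) * (x + 2)))"
    by (rule arg_cong2[where f = "(/)"]) algebra+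
  also have "\<dots> = (4 * x + 2) * F / (f * ((x + 1) * f) * (x + 2))"
    using assms by (intro mult_divide_mult_cancel_left) simp
  finally show ?thesis by simp
qed

text \<open>
  These are the Catalan numbers.  On the diagonal the differential equation of the kernel root in the
  outer variable reduces to their first order recurrence, since its terms with a higher power of \<open>X\<close> than
  of \<open>T\<close> refer to coefficients above the diagonal.
\<close>
lemma word_count_diag: "of_nat (word_count n n) = (fact (2 * n) / (fact n * fact (n + 1)) :: rat)"
proof (induction n)
  case 0
  then show ?case by (simp add: word_count_def)
next
  case (Suc n)
  define X T :: "rat fps fps" where "X = fps_X" and "T = fps_const fps_X"
  define U where "U = (kernel_root fps_X :: rat fps fps)"
  define a where "a = euler_x U"
  have T0: "(T * F) $ i $ 0 = 0" and TS: "(T * F) $ i $ (Suc k) = F $ i $ k" for F i k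
    by (simp_all add: T_def)
  have X0: "(X * F) $ 0 = 0" and XS: "(X * F) $ (Suc i) = F $ i" for F i
    by (simp_all add: X_def)
  have num: "((numeral q :: rat fps fps) * F) $ i $ k = numeral q * F $ i $ k" for q F i k
    by (simp add: numeral_fps_const)
  have eq: "a - X*(4*a) + X*(X*(4*a)) - X*(T*(4*a)) + X*(X*(T*(4*a))) = X*(T*(2*U)) - U + X*(2*U) + 1"
    using kernel_root_euler(1)[where ?'a = rat] unfolding X_def[symmetric] T_def[symmetric] U_def[symmetric] a_def[symmetric]
    by (simp add: algebra_simps power2_eq_square)
  have an: "a $ i $ k = rat_of_nat i * U $ i $ k" for i k
    by (simp add: a_def flip: fps_of_nat)
  have Uz: "U $ i $ k = 0" if "i < k" for i k
    using kernel_root_diag[of i k] that by (simp add: U_def word_count_eq_0)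
  have Un: "U $ i $ i = rat_of_nat (word_count i i)" for i
  proof (cases i)
    case 0
    then show ?thesis by (simp add: U_def kernel_root_def word_count_def)
  qed (simp add: U_def kernel_root_diag)
  have low: "(X * (4 * a)) $ n $ Suc n = 0" "(X * (T * (4 * a))) $ n $ Suc n = 0"
  proof -
    show "(X * (4 * a)) $ n $ Suc n = 0"
      by (cases n) (simp_all only: X0 XS num an fps_zero_nth Uz less_SucI lessI mult_zero_right)
    show "(X * (T * (4 * a))) $ n $ Suc n = 0"
      by (cases n) (simp_all only: X0 XS TS num an fps_zero_nth Uz lessI mult_zero_right)
  qed
  have "a $ Suc n $ Suc n - (4 * a) $ n $ Suc n + 0 - 4 * a $ n $ n + 0 = 2 * U $ n $ n - U $ Suc n $ Suc n + (2 * U) $ n $ Suc n + 0"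
    using arg_cong[OF eq, of "\<lambda>F. F $ Suc n $ Suc n"]
    by (simp only: fps_add_nth fps_sub_nth XS TS num low fps_one_nth fps_zero_nth nat.distinct if_False refl)
  then have "(rat_of_nat n + 2) * rat_of_nat (word_count (Suc n) (Suc n)) = (4 * rat_of_nat n + 2) * rat_of_nat (word_count n n)"
    unfolding num an Uz[OF lessI] Un by (simp add: algebra_simps)
  then have V: "rat_of_nat (word_count (Suc n) (Suc n)) = (4 * rat_of_nat n + 2) * rat_of_nat (word_count n n) / (rat_of_nat n + 2)"
    by (subst eq_divide_eq) (simp add: mult.commute)
  have f: "fact (2 * Suc n) = (2 * rat_of_nat n + 2) * (2 * rat_of_nat n + 1) * fact (2 * n)"
    "fact (n + 1) = (rat_of_nat n + 1) * fact n"
    "fact (Suc n) = (rat_of_nat n + 1) * fact n"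
    "fact (Suc n + 1) = (rat_of_nat n + 2) * ((rat_of_nat n + 1) * fact n)"
    by (simp_all add: algebra_simps)
  show ?case unfolding V Suc f
    by (rule catalan_ratio) (use of_nat_0_le_iff[of n, where ?'a = rat] in \<open>linarith+, simp\<close>)
qed

section \<open>The polynomials\<close>

text \<open>
  The right hand side of the recurrence, as a polynomial in \<open>n\<close>, for \<open>A\<close>, \<open>B\<close>, \<open>C\<close> in the roles of
  \<open>Q\<close> at \<open>r - 1\<close>, \<open>r - 2\<close>, \<open>r - 3\<close>.
\<close>
definition rec_step :: "rat \<Rightarrow> rat poly \<Rightarrow> rat poly \<Rightarrow> rat poly \<Rightarrow> rat poly" where
  "rec_step r A B C =
    (- 2) * ([:1, 2:] * [:2, 2:] * [:3, 2:]) * (A \<circ>\<^sub>p [:2, 1:])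
    + 2 * [:4 - 4 * r, 3 * r + 8, 3:] * [:1, 2:] * (A \<circ>\<^sub>p [:1, 1:])
    + [:14 * r - 8, 4 * (r + 1), 4:] * [:r + 1, 1:] * A
    + 8 * [:r + 2, 1:] * ([:1, 2:] * [:2, 2:] * [:3, 2:]) * (B \<circ>\<^sub>p [:2, 1:])
    - 2 * [:16 - 10 * r, 8:] * [:r + 1, 1:] * [:1, 2:] * (B \<circ>\<^sub>p [:1, 1:])
    - 4 * [:2, 1:] * ([:r - 1, 1:] * [:r, 1:] * [:r + 1, 1:]) * B
    - 8 * ([:r + 1, 1:] * [:r + 2, 1:]) * ([:1, 2:] * [:2, 2:] * [:3, 2:]) * (C \<circ>\<^sub>p [:2, 1:])
    - 8 * [:2, 1:] * ([:r - 1, 1:] * [:r, 1:] * [:r + 1, 1:]) * [:1, 2:] * (C \<circ>\<^sub>p [:1, 1:])"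

lemma pochhammer_2: "pochhammer x 2 = x * (x + 1 :: 'a::comm_ring_1)"
  and pochhammer_3: "pochhammer x 3 = x * (x + 1) * (x + 2 :: 'a)"
  by (simp_all add: eval_nat_numeral pochhammer_Suc)

lemma poly_rec_step:
  "poly (rec_step r A B C) n =
     - 2 * pochhammer (2 * n + 1) 3 * poly A (n + 2)
     + 2 * (3 * n ^ 2 + (3 * r + 8) * n - 4 * r + 4) * (2 * n + 1) * poly A (n + 1)
     + (4 * n ^ 2 + 4 * n * (r + 1) + 14 * r - 8) * (n + r + 1) * poly A n
     + 8 * (n + r + 2) * pochhammer (2 * n + 1) 3 * poly B (n + 2)
     - 2 * (8 * n - 10 * r + 16) * (n + r + 1) * (2 * n + 1) * poly B (n + 1)
     - 4 * (n + 2) * pochhammer (n + r - 1) 3 * poly B n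
     - 8 * pochhammer (n + r + 1) 2 * pochhammer (2 * n + 1) 3 * poly C (n + 2)
     - 8 * (n + 2) * pochhammer (n + r - 1) 3 * (2 * n + 1) * poly C (n + 1)"
proof -
  have sh: "poly (P \<circ>\<^sub>p [:a, 1:]) n = poly P (n + a)" for P a
    by (simp add: poly_pcompose add.commute)
  have p: "pochhammer (2 * n + 1) 3 = (1 + 2 * n) * (2 + 2 * n) * (3 + 2 * n)"
    "pochhammer (n + r - 1) 3 = (r - 1 + n) * (r + n) * (r + 1 + n)"
    "pochhammer (n + r + 1) 2 = (r + 1 + n) * (r + 2 + n)"
    by (simp_all add: pochhammer_2 pochhammer_3 algebra_simps)
  show ?thesis
    unfolding rec_step_def p poly_add poly_diff poly_mult sh
    by (simp add: power2_eq_square) algebra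
qed

lemma degree_shift_diff:
  fixes A :: "'a::idom poly"
  shows "degree (A \<circ>\<^sub>p [:a, 1:] - A) \<le> degree A - 1"
proof (cases "degree A = 0")
  case True
  then obtain c where "A = [:c:]" by (rule degree_eq_zeroE)
  then show ?thesis by simp
next
  case False
  have "lead_coeff (A \<circ>\<^sub>p [:a, 1:]) = lead_coeff A"
    by (subst lead_coeff_comp) simp_all
  then have "coeff (A \<circ>\<^sub>p [:a, 1:] - A) (degree A) = 0"
    by (simp add: degree_pcompose)
  moreover have "degree (A \<circ>\<^sub>p [:a, 1:] - A) \<le> degree A"
    by (rule degree_diff_le) (simp_all add: degree_pcompose)
  ultimately have "degree (A \<circ>\<^sub>p [:a, 1:] - A) < degree A"
    using False by (metis eq_zero_or_degree_less gr0I less_zeroE degree_0)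
  then show ?thesis by simp
qed

lemma degree_mult_shift_diff:
  fixes A c :: "'a::idom poly"
  assumes "degree c \<le> 3" "degree A \<le> d"
  shows "degree (c * (A \<circ>\<^sub>p [:a, 1:] - A)) \<le> d + 2"
proof (cases "degree A = 0")
  case True
  then obtain e where "A = [:e:]" by (rule degree_eq_zeroE)
  then show ?thesis by simp
next
  case False
  then show ?thesis
    using degree_mult_le[of c "A \<circ>\<^sub>p [:a, 1:] - A"] degree_shift_diff[of A a] assms by linarith
qed

lemma degree_mult_bound:
  fixes c P :: "'a::idom poly"
  assumes "degree c \<le> k" "P \<noteq> 0 \<Longrightarrow> degree P + k \<le> d"
  shows "degree (c * (P \<circ>\<^sub>p [:a, 1:])) \<le> d" "degree (c * P) \<le> d"
proof -
  have "degree (c * (P \<circ>\<^sub>p [:a, 1:])) \<le> d \<and> degree (c * P) \<le> d"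
  proof (cases "P = 0")
    case False
    have "degree (P \<circ>\<^sub>p [:a, 1:]) = degree P" by (simp add: degree_pcompose)
    then show ?thesis
      using degree_mult_le[of c P] degree_mult_le[of c "P \<circ>\<^sub>p [:a, 1:]"] assms(1) assms(2)[OF False] by linarith
  qed simp
  then show "degree (c * (P \<circ>\<^sub>p [:a, 1:])) \<le> d" "degree (c * P) \<le> d" by blast+
qed

text \<open>
  The three coefficients of \<open>A\<close> have degree 3, which is one too much.  Their sum has degree at most 2, however, and
  writing the shifts of \<open>A\<close> as \<open>A\<close> plus a difference of smaller degree brings in only this sum.
\<close>
lemma degree_rec_step:
  assumes A: "degree A \<le> d" and B: "B \<noteq> 0 \<Longrightarrow> degree B + 4 \<le> d + 2" and C: "C \<noteq> 0 \<Longrightarrow> degree C + 5 \<le> d + 2"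
  shows "degree (rec_step r A B C) \<le> d + 2"
proof -
  define c1 where "c1 = [:-12, -44, -48, -16::rat:]"
  define c2 where "c2 = [:8 - 8 * r, 32 - 10 * r, 12 * r + 38, 12:]"
  define c3 where "c3 = [:(14 * r - 8) * (r + 1), 14 * r - 8 + (4 * r + 4) * (r + 1), 8 * r + 8, 4:]"
  define b1 where "b1 = 8 * [:r + 2, 1:] * ([:1, 2:] * [:2, 2:] * [:3, 2:])"
  define b2 where "b2 = 2 * [:16 - 10 * r, 8:] * [:r + 1, 1:] * [:1, 2:]"
  define b3 where "b3 = 4 * [:2, 1:] * ([:r - 1, 1:] * [:r, 1:] * [:r + 1, 1:])"
  define g1 where "g1 = 8 * ([:r + 1, 1:] * [:r + 2, 1:]) * ([:1, 2:] * [:2, 2:] * [:3, 2:])"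
  define g2 where "g2 = 8 * [:2, 1:] * ([:r - 1, 1:] * [:r, 1:] * [:r + 1, 1:]) * [:1, 2:]"
  have c: "(- 2) * ([:1, 2:] * [:2, 2:] * [:3, 2:]) = c1"
    "2 * [:4 - 4 * r, 3 * r + 8, 3:] * [:1, 2:] = c2"
    "[:14 * r - 8, 4 * (r + 1), 4:] * [:r + 1, 1:] = c3"
    by (simp_all add: c1_def c2_def c3_def numeral_poly algebra_simps)
  have sum: "c1 + c2 + c3 = [:14 * r^2 - 2 * r - 12, 4 * r^2 + 12 * r - 16, 20 * r - 2:]"
    by (simp add: c1_def c2_def c3_def algebra_simps power2_eq_square)
  have db: "degree b1 \<le> 4" "degree b2 \<le> 4" "degree b3 \<le> 4" "degree g1 \<le> 5" "degree g2 \<le> 5"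
    unfolding b1_def b2_def b3_def g1_def g2_def
    by (simp_all add: numeral_poly)
  have eq: "rec_step r A B C = c1 * (A \<circ>\<^sub>p [:2, 1:] - A) + c2 * (A \<circ>\<^sub>p [:1, 1:] - A) + (c1 + c2 + c3) * A
    + b1 * (B \<circ>\<^sub>p [:2, 1:]) - b2 * (B \<circ>\<^sub>p [:1, 1:]) - b3 * B
    - g1 * (C \<circ>\<^sub>p [:2, 1:]) - g2 * (C \<circ>\<^sub>p [:1, 1:])"
    unfolding rec_step_def c b1_def[symmetric] b2_def[symmetric] b3_def[symmetric] g1_def[symmetric] g2_def[symmetric]
    by (simp add: algebra_simps)
  have 1: "degree (c1 * (A \<circ>\<^sub>p [:2, 1:] - A)) \<le> d + 2" "degree (c2 * (A \<circ>\<^sub>p [:1, 1:] - A)) \<le> d + 2"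
    by (rule degree_mult_shift_diff[OF _ A]; simp add: c1_def c2_def)+
  have "degree (c1 + c2 + c3) \<le> 2"
    unfolding sum by simp
  then have 2: "degree ((c1 + c2 + c3) * A) \<le> d + 2"
    using degree_mult_le[of "c1 + c2 + c3" A] A by linarith
  note 3 = degree_mult_bound[OF db(1) B] degree_mult_bound[OF db(2) B] degree_mult_bound[OF db(3) B]
    degree_mult_bound[OF db(4) C] degree_mult_bound[OF db(5) C]
  show ?thesis
    unfolding eq by (intro degree_diff_le degree_add_le 1 2 3)
qed

text \<open>
  The index is shifted by two: \<open>rec_poly (r + 2)\<close> is the polynomial for \<open>r\<close>, so that the two zero
  polynomials for negative \<open>r\<close> that the recurrence looks back at are part of the sequence.
\<close>
fun rec_poly :: "nat \<Rightarrow> rat poly" where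
  "rec_poly 0 = 0"
| "rec_poly (Suc 0) = 0"
| "rec_poly (Suc (Suc 0)) = 1"
| "rec_poly (Suc (Suc (Suc m))) =
     smult (1 / (6 * (of_nat m + 1)))
       (rec_step (of_nat m + 1) (rec_poly (Suc (Suc m))) (rec_poly (Suc m)) (rec_poly m))"

lemma degree_rec_poly: "degree (rec_poly m) \<le> 2 * m - 4"
proof (induction m rule: rec_poly.induct)
  case (4 m)
  have B: "rec_poly (Suc m) \<noteq> 0 \<Longrightarrow> degree (rec_poly (Suc m)) + 4 \<le> 2 * m + 2"
    using 4 by (cases m) auto
  have C: "rec_poly m \<noteq> 0 \<Longrightarrow> degree (rec_poly m) + 5 \<le> 2 * m + 2"
    using 4 by (cases m rule: rec_poly.cases) auto
  have "degree (rec_step (of_nat m + 1) (rec_poly (Suc (Suc m))) (rec_poly (Suc m)) (rec_poly m)) \<le> 2 * m + 2"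
    by (rule degree_rec_step[OF _ B C]) (use 4 in auto)
  then show ?case
    using degree_smult_le order_trans by fastforce
qed auto

text \<open>
  The number that \<open>rec_poly m\<close> has to describe, for \<open>m = r + 2\<close>.  For \<open>m < 2\<close> it would count partitions
  with more blocks than elements, of which there are none; this case is separate because at \<open>n = 0\<close> the
  truncated subtraction would count the empty partition.
\<close>
definition shifted_count :: "nat \<Rightarrow> nat \<Rightarrow> rat" where
  "shifted_count m n = (if m < 2 then 0 else of_nat (word_count (n + m - 2) n))"

lemma shifted_count_recurrence:
  fixes m n :: nat
  defines "N \<equiv> rat_of_nat n + rat_of_nat m + 1" and "K \<equiv> rat_of_nat n"
  shows "6 * (N - K) * shifted_count (m+3) n =
    - (K + 1) * (N + 2) * shifted_count (m+2) (n+2) + (3*N*K + 12*K - 4*N + 4) * shifted_count (m+2) (n+1)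
    + (4*N*K - 10*K + 14*N - 8) * shifted_count (m+2) n + 4 * (K + 1) * (N + 2) * shifted_count (m+1) (n+2)
    - (18*K - 10*N + 16) * shifted_count (m+1) (n+1) - 4 * (K + 2) * (N - 1) * shifted_count (m+1) n
    - 4 * (K + 1) * (N + 2) * shifted_count m (n+2) - 4 * (K + 2) * (N - 1) * shifted_count m (n+1)"
proof -
  have s: "shifted_count (m+3) n = of_nat (word_count (n+m+1) n)"
    "shifted_count (m+2) (n+2) = of_nat (word_count (n+m+2) (n+2))"
    "shifted_count (m+2) (n+1) = of_nat (word_count (n+m+1) (n+1))"
    "shifted_count (m+2) n = of_nat (word_count (n+m) n)"
    by (simp_all add: shifted_count_def)
  have s2: "shifted_count (m+1) (n+2) = of_nat (word_count (n+m+1) (n+2))"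
    "shifted_count (m+1) (n+1) = of_nat (word_count (n+m) (n+1))"
    "shifted_count m (n+2) = of_nat (word_count (n+m) (n+2))"
    by (auto simp: shifted_count_def word_count_eq_0)
  have s3: "shifted_count (m+1) n = (if n + m = 0 then 0 else of_nat (word_count (n+m-1) n))"
    "shifted_count m (n+1) = (if n + m = 0 then 0 else of_nat (word_count (n+m-1) (n+1)))"
    by (auto simp: shifted_count_def word_count_eq_0)
  show ?thesis
  proof (cases "n + m = 0")
    case True
    show ?thesis
      using word_count_recurrence[of n m] unfolding s s2 s3 N_def K_def if_P[OF True] by algebra
  next
    case False
    show ?thesis
      using word_count_recurrence[of n m] unfolding s s2 s3 N_def K_def if_not_P[OF False] by algebra
  qed
qed

lemma fact_double_ratio:
  "fact (2 * Suc n) / fact (Suc n) = 2 * (2 * of_nat n + 1) * (fact (2 * n) / fact n :: 'a::field_char_0)"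
proof -
  have f1: "fact (2 * Suc n) = (of_nat n + 1) * (2 * (2 * of_nat n + 1) * fact (2 * n) :: 'a)"
    by (simp add: algebra_simps)
  have f2: "fact (Suc n) = (of_nat n + 1) * (fact n :: 'a)" by simp
  have nz: "of_nat n + 1 \<noteq> (0 :: 'a)" using of_nat_neq_0[of n] by (simp add: add.commute)
  show ?thesis
    by (simp only: f1 f2 mult_divide_mult_cancel_left[OF nz] times_divide_eq_right)
qed

text \<open>
  The hypergeometric factor turns the recurrence of the counts into the one of the polynomials: with \<open>c\<close>
  denoting the factor at \<open>(m + 3, n)\<close>, each of the neighbouring factors is \<open>c\<close> times a polynomial, except
  for the one at \<open>(m + 2, n + 2)\<close>, whose denominator \<open>N + 2\<close> cancels against the recurrence.
\<close>
lemma shifted_count_eq: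
  "shifted_count m n = fact (2 * n) / (fact n * fact (n + m - 1)) * poly (rec_poly m) (of_nat n)"
proof (induction m arbitrary: n rule: rec_poly.induct)
  case 3
  then show ?case using word_count_diag[of n] by (simp add: shifted_count_def)
next
  case (4 m)
  define N where "N = rat_of_nat n + rat_of_nat m + 1"
  define K where "K = rat_of_nat n"
  define e where "e j = (fact (2 * (n + j)) / fact (n + j) :: rat)" for j
  define h where "h = (fact (n + m) :: rat)"
  define c where "c = e 0 / ((N + 1) * N * h)"
  have pos: "N \<noteq> 0" "N + 1 \<noteq> 0" "N + 2 \<noteq> 0"
    unfolding N_def by linarith+
  have h: "fact (n + m + 1) = N * h" "fact (n + m + 2) = (N + 1) * N * h" "fact (n + m + 3) = (N + 2) * (N + 1) * N * h"
    by (simp_all add: h_def N_def numeral_2_eq_2 numeral_3_eq_3 algebra_simps)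
  have h0: "h \<noteq> 0" by (simp add: h_def)
  have e0: "e 0 = (N + 1) * N * h * c" using pos h0 by (simp add: c_def)
  have e_Suc: "e (Suc j) = 2 * (2 * (K + of_nat j) + 1) * e j" for j
    unfolding e_def K_def using fact_double_ratio[of "n + j"] by (simp only: add_Suc_right of_nat_add)
  have e1: "e 1 = 2 * (2 * K + 1) * e 0"
    using e_Suc[of 0] by simp
  have "e 2 = 2 * (2 * (K + 1) + 1) * e 1"
    using e_Suc[of 1] by (simp only: Suc_1 of_nat_1)
  then have e2: "e 2 = 4 * (2 * K + 1) * (2 * K + 3) * e 0"
    unfolding e1 by algebra
  define a where "a i = poly (rec_poly (m + 2)) (K + i)" for i
  define b where "b i = poly (rec_poly (m + 1)) (K + i)" for i
  define g where "g i = poly (rec_poly m) (K + i)" for i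
  have ih: "shifted_count (m+2) (n+j) = e j / fact (n + m + 1 + j) * a (of_nat j)"
    "shifted_count (m+1) (n+j) = e j / fact (n + m + j) * b (of_nat j)"
    "shifted_count m (n+j) = e j / fact (n + m + j - 1) * g (of_nat j)" for j
    using 4[of "n + j"] by (simp_all add: e_def a_def b_def g_def K_def add_ac)
  have idx: "n + m + 1 + 2 = n + m + 3" "n + m + 1 + 1 = n + m + 2" "n + m + 2 - 1 = n + m + 1" "n + m + 1 - 1 = n + m"
    by simp_all
  have A: "(N + 2) * shifted_count (m+2) (n+2) = 4 * (2 * K + 1) * (2 * K + 3) * c * a 2"
    "shifted_count (m+2) (n+1) = 2 * (2 * K + 1) * c * a 1"
    "shifted_count (m+2) n = (N + 1) * c * a 0"
    using ih(1)[of 2] ih(1)[of 1] ih(1)[of 0] h0 pos unfolding idx e1 e2 e0 h add_0_right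
    by (simp_all add: h)
  have B: "shifted_count (m+1) (n+2) = 4 * (2 * K + 1) * (2 * K + 3) * c * b 2"
    "shifted_count (m+1) (n+1) = 2 * (2 * K + 1) * (N + 1) * c * b 1"
    "shifted_count (m+1) n = (N + 1) * N * c * b 0"
    using ih(2)[of 2] ih(2)[of 1] ih(2)[of 0] h0 pos unfolding idx e1 e2 e0 h h_def[symmetric] add_0_right
    by (simp_all add: h)
  have C: "shifted_count m (n+2) = 4 * (2 * K + 1) * (2 * K + 3) * (N + 1) * c * g 2"
    "shifted_count m (n+1) = 2 * (2 * K + 1) * (N + 1) * N * c * g 1"
    using ih(3)[of 2] ih(3)[of 1] h0 pos unfolding idx e1 e2 e0 h h_def[symmetric]
    by simp_all
  have r: "rat_of_nat m + 1 = N - K" by (simp add: N_def K_def)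
  have p: "poly (rec_step (N - K) (rec_poly (m+2)) (rec_poly (m+1)) (rec_poly m)) K =
     - 2 * ((2 * K + 1) * (2 * K + 1 + 1) * (2 * K + 1 + 2)) * a 2
     + 2 * (3 * K ^ 2 + (3 * (N - K) + 8) * K - 4 * (N - K) + 4) * (2 * K + 1) * a 1
     + (4 * K ^ 2 + 4 * K * (N - K + 1) + 14 * (N - K) - 8) * (K + (N - K) + 1) * a 0
     + 8 * (K + (N - K) + 2) * ((2 * K + 1) * (2 * K + 1 + 1) * (2 * K + 1 + 2)) * b 2
     - 2 * (8 * K - 10 * (N - K) + 16) * (K + (N - K) + 1) * (2 * K + 1) * b 1
     - 4 * (K + 2) * ((N - 1) * N * (N + 1)) * b 0
     - 8 * ((N + 1) * (N + 2)) * ((2 * K + 1) * (2 * K + 1 + 1) * (2 * K + 1 + 2)) * g 2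
     - 8 * (K + 2) * ((N - 1) * N * (N + 1)) * (2 * K + 1) * g 1"
  proof -
    have "pochhammer (K + (N - K) - 1) 3 = (N - 1) * N * (N + 1)" "pochhammer (K + (N - K) + 1) 2 = (N + 1) * (N + 2)"
      by (simp_all add: pochhammer_2 pochhammer_3 add.commute)
    then show ?thesis
      unfolding poly_rec_step a_def b_def g_def by (simp only: pochhammer_3 add_0_right)
  qed
  have main: "6 * (N - K) * shifted_count (m+3) n = c * poly (rec_step (N - K) (rec_poly (m+2)) (rec_poly (m+1)) (rec_poly m)) K"
  proof -
    have "6 * (N - K) * shifted_count (m+3) n =
      - (K + 1) * ((N + 2) * shifted_count (m+2) (n+2)) + (3*N*K + 12*K - 4*N + 4) * shifted_count (m+2) (n+1)
      + (4*N*K - 10*K + 14*N - 8) * shifted_count (m+2) n + 4 * (K + 1) * (N + 2) * shifted_count (m+1) (n+2)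
      - (18*K - 10*N + 16) * shifted_count (m+1) (n+1) - 4 * (K + 2) * (N - 1) * shifted_count (m+1) n
      - 4 * (K + 1) * (N + 2) * shifted_count m (n+2) - 4 * (K + 2) * (N - 1) * shifted_count m (n+1)"
      using shifted_count_recurrence[of n m] unfolding N_def K_def by (simp only: mult.assoc)
    also have "\<dots> = c * poly (rec_step (N - K) (rec_poly (m+2)) (rec_poly (m+1)) (rec_poly m)) K"
      unfolding A B C p by algebra
    finally show ?thesis .
  qed
  have nz: "N - K \<noteq> 0" unfolding r[symmetric] by linarith
  have "6 * (N - K) * poly (rec_poly (Suc (Suc (Suc m)))) K =
    poly (rec_step (N - K) (rec_poly (m+2)) (rec_poly (m+1)) (rec_poly m)) K"
    using nz by (simp add: r)
  then have "(6 * (N - K)) * shifted_count (m+3) n = (6 * (N - K)) * (c * poly (rec_poly (Suc (Suc (Suc m)))) K)"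
    unfolding main by (simp only: mult.left_commute[of _ c])
  then have "shifted_count (m+3) n = c * poly (rec_poly (Suc (Suc (Suc m)))) K"
    using nz by (subst (asm) mult_left_cancel) simp_all
  moreover have "c = fact (2 * n) / (fact n * fact (n + Suc (Suc (Suc m)) - 1))"
    using h(2) by (simp add: c_def e_def)
  ultimately show ?case by (simp only: K_def add_Suc_right add_0_right numeral_3_eq_3)
qed (simp_all add: shifted_count_def)

theorem theorem3p9:
  shows "\<exists>Q :: int \<Rightarrow> rat poly.
    (\<forall>r::nat. degree (Q (int r)) \<le> 2 * r \<and>
       (\<forall>n::nat. rat_of_nat (op_321 (n + r) n) =
          fact (2 * n) / (fact n * fact (n + r + 1)) * poly (Q (int r)) (rat_of_nat n))) \<and>
    Q 0 = 1 \<and>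
    (\<forall>j<0. Q j = 0) \<and>
    (\<forall>r::int. r \<ge> 1 \<longrightarrow> (\<forall>n::rat.
       6 * rat_of_int r * poly (Q r) n =
         - 2 * pochhammer (2 * n + 1) 3 * poly (Q (r - 1)) (n + 2)
         + 2 * (3 * n ^ 2 + (3 * rat_of_int r + 8) * n - 4 * rat_of_int r + 4) * (2 * n + 1)
             * poly (Q (r - 1)) (n + 1)
         + (4 * n ^ 2 + 4 * n * (rat_of_int r + 1) + 14 * rat_of_int r - 8)
             * (n + rat_of_int r + 1) * poly (Q (r - 1)) n
         + 8 * (n + rat_of_int r + 2) * pochhammer (2 * n + 1) 3 * poly (Q (r - 2)) (n + 2)
         - 2 * (8 * n - 10 * rat_of_int r + 16) * (n + rat_of_int r + 1) * (2 * n + 1)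
             * poly (Q (r - 2)) (n + 1)
         - 4 * (n + 2) * pochhammer (n + rat_of_int r - 1) 3 * poly (Q (r - 2)) n
         - 8 * pochhammer (n + rat_of_int r + 1) 2 * pochhammer (2 * n + 1) 3
             * poly (Q (r - 3)) (n + 2)
         - 8 * (n + 2) * pochhammer (n + rat_of_int r - 1) 3 * (2 * n + 1)
             * poly (Q (r - 3)) (n + 1)))"
proof -
  define Q where "Q j = rec_poly (nat (j + 2))" for j
  have Q_nat: "Q (int r) = rec_poly (r + 2)" for r
    by (simp add: Q_def nat_add_distrib)
  have deg: "degree (Q (int r)) \<le> 2 * r" for r
    using degree_rec_poly[of "r + 2"] by (simp add: Q_nat)
  have formula: "rat_of_nat (op_321 (n + r) n) =
      fact (2 * n) / (fact n * fact (n + r + 1)) * poly (Q (int r)) (rat_of_nat n)" for n r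
    using shifted_count_eq[of "r + 2" n]
    by (simp add: Q_nat shifted_count_def op_321_eq_word_count)
  have Q_neg: "Q j = 0" if "j < 0" for j
  proof -
    have "nat (j + 2) = 0 \<or> nat (j + 2) = 1" using that by linarith
    then show ?thesis by (auto simp: Q_def)
  qed
  have rec: "6 * rat_of_int r * poly (Q r) n =
      poly (rec_step (rat_of_int r) (Q (r - 1)) (Q (r - 2)) (Q (r - 3))) n" if "r \<ge> 1" for r n
  proof -
    define m where "m = nat (r - 1)"
    have r: "r = int m + 1" using that by (simp add: m_def)
    have ix: "nat (r + 2) = Suc (Suc (Suc m))" "nat (r - 1 + 2) = Suc (Suc m)" "nat (r - 2 + 2) = Suc m" "nat (r - 3 + 2) = m"
      unfolding r by simp_all
    have "rat_of_nat m + 1 \<noteq> 0" by linarith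
    then show ?thesis unfolding Q_def ix by (simp add: r)
  qed
  show ?thesis
  proof (intro exI[of _ Q] conjI allI impI)
    show "Q 0 = 1" using Q_nat[of 0] by (simp add: numeral_2_eq_2)
  qed (rule deg formula Q_neg rec[unfolded poly_rec_step]; assumption)+
qed

end
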